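(* Let $h_{ij}\in\widehat{\mathcal{C}}_\hbar^\infty$ ($i,j\in\{1,2\}$) satisfy $h_{ij}^*=h_{ji}=h_{ij}$ and suppose there exist $h^{ij}\in\widehat{\mathcal{C}}_\hbar^\infty$ with $h^{ij}h_{jk}=h_{kj}h^{ji}=\delta^i_k$. Then, with $T\widehat{\mathcal{C}}_\hbar^\infty,h,\mathfrak{g},\varphi$ as in the context, $(T\widehat{\mathcal{C}}_\hbar^\infty,h,\mathfrak{g},\varphi)$ is a real metric calculus over $\widehat{\mathcal{C}}_\hbar^\infty$, and there is a unique affine connection $\nabla$ on $(T\widehat{\mathcal{C}}_\hbar^\infty,\mathfrak{g})$ making $(T\widehat{\mathcal{C}}_\hbar^\infty,h,\mathfrak{g},\varphi,\nabla)$ a pseudo-Riemannian calculus; it is given by $\nabla_{\partial_i}e_j=e_l\Gamma^l_{ij}$ with $$\Gamma^l_{ij}=\tfrac12h^{lk}\big(\partial_ih_{jk}+\partial_jh_{ki}-\partial_kh_{ij}\big).$$ Moreover, if $h_{ij}=e^{2k(u)}\delta_{ij}$ with $k\in C^\infty(\mathbb{R})$ real-valued, then $$\nabla_{\partial_1}e_1=e_1k'(u),\quad\nabla_{\partial_1}e_2=\nabla_{\partial_2}e_1=e_2k'(u),\quad\nabla_{\partial_2}e_2=-e_1k'(u),$$ and the Gaussian curvature is $K=\frac12h^{ij}R_{ikjl}h^{kl}=-e^{-2k(u)}k''(u)$.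
   Context: Repeated up-down indices are summed from 1 to 2; $\hbar\in\mathbb{R}$. $\widehat{\mathcal{C}}_\hbar^\infty$ is the unital $*$-algebra of finite sums $f=\sum_nf_n(u)W^n$, $f_n\in C^\infty(\mathbb{R})$ (complex-valued), $W=e^{2\pi it}$, with product $fg=\sum_{n}\big[\sum_{k}f_k(u)g_{n-k}(u+k\hbar)\big]W^n$ and involution $f^*=\sum_n\overline{f_{-n}(u+n\hbar)}W^n$. $\mathfrak{g}$ is the real abelian Lie algebra spanned by the hermitian derivations $\partial_1f=\sum_nf_n'(u)W^n$ and $\partial_2f=2\pi i\sum_nnf_n(u)W^n$ (a derivation $\partial$ is hermitian if $\partial(f)^*=\partial(f^* )$). $T\widehat{\mathcal{C}}_\hbar^\infty$ is the free right $\widehat{\mathcal{C}}_\hbar^\infty$-module of rank 2 with basis $e_1,e_2$, $h(X,Y)=(X^i)^*h_{ij}Y^j$ for $X=e_iX^i$, $Y=e_iY^i$, and $\varphi:\mathfrak{g}\to T\widehat{\mathcal{C}}_\hbar^\infty$ is the $\mathbb{R}$-linear map with $\varphi(\partial_k)=e_k$. For a $*$-algebra $\mathcal{A}$: let $M$ be a right $\mathcal{A}$-module, $h$ a nondegenerate $\mathcal{A}$-valued hermitian form on $M$, $\mathfrak{g}$ a real Lie algebra of hermitian derivations of $\mathcal{A}$ and $\varphi:\mathfrak{g}\to M$ an $\mathbb{R}$-linear map. $(M,h,\mathfrak{g},\varphi)$ is a real metric calculus if $M_\varphi=\varphi(\mathfrak{g})$ generates $M$ as an $\mathcal{A}$-module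 and $h(E,E')^*=h(E,E')$ for all $E,E'\in M_\varphi$. An affine connection on $(M,\mathfrak{g})$ is a map $\nabla:\mathfrak{g}\times M\to M$ with $\nabla_\partial(U+V)=\nabla_\partial U+\nabla_\partial V$, $\nabla_{\lambda\partial+\partial'}U=\lambda\nabla_\partial U+\nabla_{\partial'}U$ and $\nabla_\partial(Ua)=(\nabla_\partial U)a+U\partial(a)$ for $U,V\in M$, $\partial,\partial'\in\mathfrak{g}$, $a\in\mathcal{A}$, $\lambda\in\mathbb{R}$. $(M,h,\mathfrak{g},\varphi,\nabla)$ is a pseudo-Riemannian calculus if moreover $h(\nabla_\partial E,E')=h(\nabla_\partial E,E')^*$ for all $E,E'\in M_\varphi$, $\partial\in\mathfrak{g}$ (real connection calculus), $\partial(h(U,V))=h(\nabla_\partial U,V)+h(U,\nabla_\partial V)$ for all $U,V\in M$, $\partial\in\mathfrak{g}$ (metric), and $\nabla_\partial\varphi(\partial')-\nabla_{\partial'}\varphi(\partial)-\varphi([\partial,\partial'])=0$ for all $\partial,\partial'\in\mathfrak{g}$ (torsion-free). Curvature: $R(\partial_i,\partial_j)U=\nabla_{\partial_i}\nabla_{\partial_j}U-\nabla_{\partial_j}\nabla_{\partial_i}U$ and $R_{ijkl}=h(e_i,R(\partial_k,\partial_l)e_j)$. *)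

theory Defs
  imports "HOL-Analysis.Analysis" "HOL-Library.Poly_Mapping"
begin

section \<open>Real metric calculi and pseudo-Riemannian calculi over a complex \<open>*\<close>-algebra\<close>

text \<open>
  The product of an algebra is a locale parameter and not the \<open>times\<close> of a type class, because the
  concrete algebra below carries a different product on the same type for each real \<open>hbar\<close>.
\<close>

locale star_algebra = vector_space scale
  for scale :: "complex \<Rightarrow> 'a::ab_group_add \<Rightarrow> 'a" +
  fixes mult :: "'a \<Rightarrow> 'a \<Rightarrow> 'a"
    and unit :: 'a
    and star :: "'a \<Rightarrow> 'a"
  assumes mult_assoc: "mult (mult a b) c = mult a (mult b c)"
    and mult_add_left: "mult (a + b) c = mult a c + mult b c"
    and mult_add_right: "mult a (b + c) = mult a b + mult a c"
    and mult_scale_left: "mult (scale z a) b = scale z (mult a b)"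
    and mult_scale_right: "mult a (scale z b) = scale z (mult a b)"
    and mult_unit_left: "mult unit a = a"
    and mult_unit_right: "mult a unit = a"
    and star_add: "star (a + b) = star a + star b"
    and star_scale: "star (scale z a) = scale (cnj z) (star a)"
    and star_mult: "star (mult a b) = mult (star b) (star a)"
    and star_star: "star (star a) = a"
begin

definition derivation :: "('a \<Rightarrow> 'a) \<Rightarrow> bool" where
  "derivation d \<longleftrightarrow>
     (\<forall>a b. d (a + b) = d a + d b) \<and>
     (\<forall>z a. d (scale z a) = scale z (d a)) \<and>
     (\<forall>a b. d (mult a b) = mult (d a) b + mult a (d b))"

definition hermitian_derivation :: "('a \<Rightarrow> 'a) \<Rightarrow> bool" where
  "hermitian_derivation d \<longleftrightarrow> derivation d \<and> (\<forall>a. star (d a) = d (star a))"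

definition real_lincomb :: "real \<Rightarrow> ('a \<Rightarrow> 'a) \<Rightarrow> ('a \<Rightarrow> 'a) \<Rightarrow> 'a \<Rightarrow> 'a" where
  "real_lincomb r d d' = (\<lambda>a. scale (of_real r) (d a) + d' a)"

definition commutator :: "('a \<Rightarrow> 'a) \<Rightarrow> ('a \<Rightarrow> 'a) \<Rightarrow> 'a \<Rightarrow> 'a" where
  "commutator d d' = (\<lambda>a. d (d' a) - d' (d a))"

definition lie_algebra_of_hermitian_derivations :: "('a \<Rightarrow> 'a) set \<Rightarrow> bool" where
  "lie_algebra_of_hermitian_derivations g \<longleftrightarrow>
     (\<forall>d\<in>g. hermitian_derivation d) \<and>
     (\<lambda>_. 0) \<in> g \<and>
     (\<forall>r. \<forall>d\<in>g. \<forall>d'\<in>g. real_lincomb r d d' \<in> g) \<and>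
     (\<forall>d\<in>g. \<forall>d'\<in>g. commutator d d' \<in> g)"

end

locale right_module = star_algebra scale mult unit star
  for scale :: "complex \<Rightarrow> 'a::ab_group_add \<Rightarrow> 'a" and mult unit star +
  fixes act :: "'m::ab_group_add \<Rightarrow> 'a \<Rightarrow> 'm"
  assumes act_add_left: "act (U + V) a = act U a + act V a"
    and act_add_right: "act U (a + b) = act U a + act U b"
    and act_mult: "act U (mult a b) = act (act U a) b"
    and act_unit: "act U unit = U"
begin

text \<open>Scalars act on a module over a unital algebra through the multiples of the unit.\<close>

definition real_scale :: "real \<Rightarrow> 'm \<Rightarrow> 'm" where
  "real_scale r U = act U (scale (of_real r) unit)"

definition submodule :: "'m set \<Rightarrow> bool" where
  "submodule N \<longleftrightarrow> 0 \<in> N \<and> (\<forall>U\<in>N. \<forall>V\<in>N. U + V \<in> N) \<and> (\<forall>U\<in>N. \<forall>a. act U a \<in> N)"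

definition affine_connection ::
    "('a \<Rightarrow> 'a) set \<Rightarrow> (('a \<Rightarrow> 'a) \<Rightarrow> 'm \<Rightarrow> 'm) \<Rightarrow> bool" where
  "affine_connection g D \<longleftrightarrow>
     (\<forall>d\<in>g. \<forall>U V. D d (U + V) = D d U + D d V) \<and>
     (\<forall>r. \<forall>d\<in>g. \<forall>d'\<in>g. \<forall>U. D (real_lincomb r d d') U = real_scale r (D d U) + D d' U) \<and>
     (\<forall>d\<in>g. \<forall>U a. D d (act U a) = act (D d U) a + act U (d a))"

end

locale nondegenerate_hermitian_form = right_module scale mult unit star act
  for scale :: "complex \<Rightarrow> 'a::ab_group_add \<Rightarrow> 'a" and mult unit star
    and act :: "'m::ab_group_add \<Rightarrow> 'a \<Rightarrow> 'm" +
  fixes h :: "'m \<Rightarrow> 'm \<Rightarrow> 'a"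
  assumes h_add_right: "h U (V + W) = h U V + h U W"
    and h_act_right: "h U (act V a) = mult (h U V) a"
    and h_star: "star (h U V) = h V U"
    and h_nondegenerate: "(\<And>V. h U V = 0) \<Longrightarrow> U = 0"

locale real_metric_calculus = nondegenerate_hermitian_form scale mult unit star act h
  for scale :: "complex \<Rightarrow> 'a::ab_group_add \<Rightarrow> 'a" and mult unit star
    and act :: "'m::ab_group_add \<Rightarrow> 'a \<Rightarrow> 'm" and h +
  fixes g :: "('a \<Rightarrow> 'a) set"
    and \<phi> :: "('a \<Rightarrow> 'a) \<Rightarrow> 'm"
  assumes lie_algebra: "lie_algebra_of_hermitian_derivations g"
    and \<phi>_linear:
      "d \<in> g \<Longrightarrow> d' \<in> g \<Longrightarrow> \<phi> (real_lincomb r d d') = real_scale r (\<phi> d) + \<phi> d'"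
    and \<phi>_generates: "submodule hull (\<phi> ` g) = UNIV"
    and h_hermitian: "E \<in> \<phi> ` g \<Longrightarrow> E' \<in> \<phi> ` g \<Longrightarrow> star (h E E') = h E E'"

locale pseudo_riemannian_calculus = real_metric_calculus scale mult unit star act h g \<phi>
  for scale :: "complex \<Rightarrow> 'a::ab_group_add \<Rightarrow> 'a" and mult unit star
    and act :: "'m::ab_group_add \<Rightarrow> 'a \<Rightarrow> 'm" and h g \<phi> +
  fixes D :: "('a \<Rightarrow> 'a) \<Rightarrow> 'm \<Rightarrow> 'm"
  assumes connection: "affine_connection g D"
    and connection_real:
      "d \<in> g \<Longrightarrow> E \<in> \<phi> ` g \<Longrightarrow> E' \<in> \<phi> ` g \<Longrightarrow> h (D d E) E' = star (h (D d E) E')"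
    and connection_metric: "d \<in> g \<Longrightarrow> d (h U V) = h (D d U) V + h U (D d V)"
    and torsion_free:
      "d \<in> g \<Longrightarrow> d' \<in> g \<Longrightarrow> D d (\<phi> d') - D d' (\<phi> d) - \<phi> (commutator d d') = 0"


section \<open>Smooth complex-valued functions on the real line\<close>

definition vderiv :: "(real \<Rightarrow> 'b::real_normed_vector) \<Rightarrow> real \<Rightarrow> 'b" where
  "vderiv f = (\<lambda>x. vector_derivative f (at x))"

definition smooth :: "(real \<Rightarrow> 'b::real_normed_vector) \<Rightarrow> bool" where
  "smooth f \<longleftrightarrow> (\<forall>n x. (vderiv ^^ n) f differentiable (at x))"

fun cdiff :: "nat \<Rightarrow> (real \<Rightarrow> 'b::real_normed_vector) \<Rightarrow> bool" where
  "cdiff 0 f \<longleftrightarrow> (\<forall>x. f differentiable (at x))"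
| "cdiff (Suc n) f \<longleftrightarrow> (\<forall>x. f differentiable (at x)) \<and> cdiff n (vderiv f)"

lemma cdiff_iff: "cdiff n f \<longleftrightarrow> (\<forall>m\<le>n. \<forall>x. (vderiv ^^ m) f differentiable (at x))"
proof (induction n arbitrary: f)
  case (Suc n)
  have "(\<forall>m\<le>Suc n. P m) \<longleftrightarrow> P 0 \<and> (\<forall>m\<le>n. P (Suc m))" for P :: "nat \<Rightarrow> bool"
    by (metis Suc_le_mono not0_implies_Suc zero_le)
  from this[of "\<lambda>m. \<forall>x. (vderiv ^^ m) f differentiable (at x)"] show ?case
    by (simp add: Suc funpow_swap1)
qed simp

lemma smooth_iff: "smooth f \<longleftrightarrow> (\<forall>n. cdiff n f)"
  unfolding smooth_def cdiff_iff by auto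

lemma smooth_vderiv: "smooth f \<Longrightarrow> smooth (vderiv f)"
  unfolding smooth_iff by (metis cdiff.simps(2))

lemma cdiff_differentiable: "cdiff n f \<Longrightarrow> f differentiable (at x)"
  by (cases n) auto

lemma cdiff_Suc_D: "cdiff (Suc n) f \<Longrightarrow> cdiff n f"
  unfolding cdiff_iff by auto

lemma cdiff_has_vderiv: "cdiff n f \<Longrightarrow> (f has_vector_derivative vderiv f x) (at x)"
  by (simp add: vderiv_def cdiff_differentiable flip: vector_derivative_works)

lemma cdiff_SucI:
  assumes "\<And>x. (f has_vector_derivative f' x) (at x)" "cdiff n f'"
  shows "cdiff (Suc n) f"
proof -
  have "vderiv f = f'" using assms(1) by (auto simp: vderiv_def vector_derivative_at)
  thus ?thesis using assms differentiableI_vector by auto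
qed

lemma cdiff_const: "cdiff n (\<lambda>_. c)"
proof (induction n arbitrary: c)
  case (Suc n)
  show ?case by (rule cdiff_SucI[OF has_vector_derivative_const Suc])
qed simp

lemma cdiff_add: "cdiff n f \<Longrightarrow> cdiff n g \<Longrightarrow> cdiff n (\<lambda>x. f x + g x)"
proof (induction n arbitrary: f g)
  case (Suc n)
  show ?case
    by (rule cdiff_SucI[OF has_vector_derivative_add[OF Suc.prems[THEN cdiff_has_vderiv]]])
      (use Suc in auto)
qed auto

lemma cdiff_bounded_linear: "bounded_linear L \<Longrightarrow> cdiff n f \<Longrightarrow> cdiff n (\<lambda>x. L (f x))"
proof (induction n arbitrary: f)
  case 0
  thus ?case
    using bounded_linear.has_vector_derivative[OF 0(1) cdiff_has_vderiv[OF 0(2)]]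
    by (auto intro: differentiableI_vector)
next
  case (Suc n)
  show ?case
    by (rule cdiff_SucI[OF bounded_linear.has_vector_derivative[OF Suc.prems(1)
          cdiff_has_vderiv[OF Suc.prems(2)]]]) (use Suc in auto)
qed

lemma cdiff_mult:
  fixes f g :: "real \<Rightarrow> 'b::real_normed_algebra"
  shows "cdiff n f \<Longrightarrow> cdiff n g \<Longrightarrow> cdiff n (\<lambda>x. f x * g x)"
proof (induction n arbitrary: f g)
  case (Suc n)
  show ?case
    by (rule cdiff_SucI[OF has_vector_derivative_mult[OF Suc.prems[THEN cdiff_has_vderiv]]])
      (intro cdiff_add Suc.IH, use Suc.prems cdiff_Suc_D in auto)
qed auto

lemma cdiff_shift: "cdiff n f \<Longrightarrow> cdiff n (\<lambda>x. f (x + a))"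
proof -
  have shift: "((\<lambda>x. f (x + a)) has_vector_derivative vderiv f (x + a)) (at x)"
    if "cdiff n f" for n x and f :: "real \<Rightarrow> 'b::real_normed_vector"
  proof -
    have "((\<lambda>x::real. x + a) has_vector_derivative 1) (at x)"
      by (auto intro!: derivative_eq_intros)
    from vector_diff_chain_at[OF this cdiff_has_vderiv[OF that]] show ?thesis
      by (simp add: o_def)
  qed
  show "cdiff n f \<Longrightarrow> cdiff n (\<lambda>x. f (x + a))"
  proof (induction n arbitrary: f)
    case 0
    thus ?case using shift[OF 0] by (auto intro: differentiableI_vector)
  next
    case (Suc n)
    show ?case by (rule cdiff_SucI[OF shift[OF Suc.prems]]) (use Suc in auto)
  qed
qed

lemma cdiff_exp:
  fixes f :: "real \<Rightarrow> complex"
  shows "cdiff n f \<Longrightarrow> cdiff n (\<lambda>x. exp (f x))"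
proof -
  have exp: "((\<lambda>x. exp (f x)) has_vector_derivative vderiv f x * exp (f x)) (at x)"
    if "cdiff n f" for n x and f :: "real \<Rightarrow> complex"
    using field_vector_diff_chain_at[OF cdiff_has_vderiv[OF that] DERIV_exp] by (simp add: o_def)
  show "cdiff n f \<Longrightarrow> cdiff n (\<lambda>x. exp (f x))"
  proof (induction n arbitrary: f)
    case 0
    thus ?case using exp[OF 0] by (auto intro: differentiableI_vector)
  next
    case (Suc n)
    show ?case
      by (rule cdiff_SucI[OF exp[OF Suc.prems]])
        (intro cdiff_mult Suc.IH, use Suc.prems cdiff_Suc_D in auto)
  qed
qed

typedef smooth_fun = "{f :: real \<Rightarrow> complex. smooth f}"
  morphisms smooth_apply Smooth_fun
  by (rule exI[of _ "\<lambda>_. 0"]) (simp add: smooth_iff cdiff_const)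

setup_lifting type_definition_smooth_fun

instantiation smooth_fun :: comm_ring_1
begin

lift_definition zero_smooth_fun :: smooth_fun is "\<lambda>_. 0"
  by (simp add: smooth_iff cdiff_const)
lift_definition one_smooth_fun :: smooth_fun is "\<lambda>_. 1"
  by (simp add: smooth_iff cdiff_const)
lift_definition plus_smooth_fun :: "smooth_fun \<Rightarrow> smooth_fun \<Rightarrow> smooth_fun" is "\<lambda>f g u. f u + g u"
  by (simp add: smooth_iff cdiff_add)
lift_definition times_smooth_fun :: "smooth_fun \<Rightarrow> smooth_fun \<Rightarrow> smooth_fun" is "\<lambda>f g u. f u * g u"
  by (simp add: smooth_iff cdiff_mult)
lift_definition uminus_smooth_fun :: "smooth_fun \<Rightarrow> smooth_fun" is "\<lambda>f u. - f u"
  by (simp add: smooth_iff cdiff_bounded_linear bounded_linear_minus bounded_linear_ident)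
lift_definition minus_smooth_fun :: "smooth_fun \<Rightarrow> smooth_fun \<Rightarrow> smooth_fun" is "\<lambda>f g u. f u - g u"
  using cdiff_add cdiff_bounded_linear[OF bounded_linear_minus[OF bounded_linear_ident]]
  unfolding smooth_iff diff_conv_add_uminus by blast

instance
  by standard (transfer; auto simp: fun_eq_iff algebra_simps)+

end

lift_definition smooth_scale :: "complex \<Rightarrow> smooth_fun \<Rightarrow> smooth_fun" is "\<lambda>z f u. z * f u"
  by (simp add: smooth_iff cdiff_mult cdiff_const)
lift_definition smooth_cnj :: "smooth_fun \<Rightarrow> smooth_fun" is "\<lambda>f u. cnj (f u)"
  by (simp add: smooth_iff cdiff_bounded_linear bounded_linear_cnj)
lift_definition smooth_shift :: "real \<Rightarrow> smooth_fun \<Rightarrow> smooth_fun" is "\<lambda>a f u. f (u + a)"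
  by (simp add: smooth_iff cdiff_shift)
lift_definition smooth_deriv :: "smooth_fun \<Rightarrow> smooth_fun" is vderiv
  by (rule smooth_vderiv)
lift_definition smooth_exp :: "smooth_fun \<Rightarrow> smooth_fun" is "\<lambda>f u. exp (f u)"
  by (simp add: smooth_iff cdiff_exp)


section \<open>The noncommutative catenoid algebra\<close>

text \<open>
  The element \<open>\<Sum>\<^sub>n f\<^sub>n(u) W\<^sup>n\<close> is the finitely supported family \<open>n \<mapsto> f\<^sub>n\<close>. Only the additive group
  and the unit \<open>W\<^sup>0\<close> of \<open>poly_mapping\<close> are used below; its convolution product \<open>(*)\<close> is the case
  \<open>hbar = 0\<close> of \<open>cat_mult\<close>.
\<close>

type_synonym catenoid = "int \<Rightarrow>\<^sub>0 smooth_fun"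

lift_definition cat_scale :: "complex \<Rightarrow> catenoid \<Rightarrow> catenoid" is
  "\<lambda>z (f :: int \<Rightarrow> smooth_fun) n. smooth_scale z (f n)"
proof -
  fix z and f :: "int \<Rightarrow> smooth_fun" assume "finite {n. f n \<noteq> 0}"
  moreover have "smooth_scale z 0 = 0" by transfer simp
  ultimately show "finite {n. smooth_scale z (f n) \<noteq> 0}"
    by (auto elim!: rev_finite_subset)
qed

lift_definition cat_mult :: "real \<Rightarrow> catenoid \<Rightarrow> catenoid \<Rightarrow> catenoid" is
  "\<lambda>hbar (f :: int \<Rightarrow> smooth_fun) (g :: int \<Rightarrow> smooth_fun) n.
     \<Sum>k | f k \<noteq> 0. f k * smooth_shift (of_int k * hbar) (g (n - k))"
proof -
  fix hbar and f g :: "int \<Rightarrow> smooth_fun"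
  assume f: "finite {n. f n \<noteq> 0}" and g: "finite {n. g n \<noteq> 0}"
  have shift0: "smooth_shift a 0 = 0" for a by transfer simp
  have "{n. (\<Sum>k | f k \<noteq> 0. f k * smooth_shift (of_int k * hbar) (g (n - k))) \<noteq> 0}
          \<subseteq> (\<lambda>(k, m). k + m) ` ({k. f k \<noteq> 0} \<times> {m. g m \<noteq> 0})" (is "?L \<subseteq> ?R")
  proof
    fix n assume "n \<in> ?L"
    then obtain k where k: "f k \<noteq> 0" "f k * smooth_shift (of_int k * hbar) (g (n - k)) \<noteq> 0"
      by (auto elim: sum.not_neutral_contains_not_neutral)
    hence "g (n - k) \<noteq> 0" by (auto simp: shift0)
    with k show "n \<in> ?R" by (auto intro!: image_eqI[of _ _ "(k, n - k)"])
  qed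
  thus "finite {n. (\<Sum>k | f k \<noteq> 0. f k * smooth_shift (of_int k * hbar) (g (n - k))) \<noteq> 0}"
    by (rule finite_subset) (use f g in auto)
qed

lift_definition cat_star :: "real \<Rightarrow> catenoid \<Rightarrow> catenoid" is
  "\<lambda>hbar (f :: int \<Rightarrow> smooth_fun) n. smooth_cnj (smooth_shift (of_int n * hbar) (f (- n)))"
proof -
  fix hbar and f :: "int \<Rightarrow> smooth_fun" assume f: "finite {n. f n \<noteq> 0}"
  have "smooth_cnj (smooth_shift a 0) = 0" for a by transfer simp
  hence "{n. smooth_cnj (smooth_shift (of_int n * hbar) (f (- n))) \<noteq> 0} \<subseteq> uminus ` {n. f n \<noteq> 0}"
    by (auto intro!: image_eqI[of _ uminus "- _"])
  thus "finite {n. smooth_cnj (smooth_shift (of_int n * hbar) (f (- n))) \<noteq> 0}"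
    by (rule finite_subset) (use f in auto)
qed

lift_definition cat_deriv1 :: "catenoid \<Rightarrow> catenoid" is
  "\<lambda>(f :: int \<Rightarrow> smooth_fun) n. smooth_deriv (f n)"
proof -
  fix f :: "int \<Rightarrow> smooth_fun" assume "finite {n. f n \<noteq> 0}"
  moreover have "smooth_deriv 0 = 0" by transfer (simp add: vderiv_def)
  ultimately show "finite {n. smooth_deriv (f n) \<noteq> 0}"
    by (auto elim!: rev_finite_subset)
qed

lift_definition cat_deriv2 :: "catenoid \<Rightarrow> catenoid" is
  "\<lambda>(f :: int \<Rightarrow> smooth_fun) n. smooth_scale (2 * of_real pi * \<i> * of_int n) (f n)"
proof -
  fix f :: "int \<Rightarrow> smooth_fun" assume "finite {n. f n \<noteq> 0}"
  moreover have "smooth_scale z 0 = 0" for z by transfer simp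
  ultimately show "finite {n. smooth_scale (2 * of_real pi * \<i> * of_int n) (f n) \<noteq> 0}"
    by (auto elim!: rev_finite_subset)
qed

abbreviation fun_of_u :: "smooth_fun \<Rightarrow> catenoid" where
  "fun_of_u f \<equiv> Poly_Mapping.single 0 f"

text \<open>In the two-element index type \<open>2\<close> the numeral \<open>2\<close> is the element different from \<open>1\<close>.\<close>

definition cat_deriv :: "2 \<Rightarrow> catenoid \<Rightarrow> catenoid" where
  "cat_deriv i = (if i = 1 then cat_deriv1 else cat_deriv2)"

definition cat_comb :: "real ^ 2 \<Rightarrow> catenoid \<Rightarrow> catenoid" where
  "cat_comb c = (\<lambda>f. \<Sum>i\<in>UNIV. cat_scale (of_real (c $ i)) (cat_deriv i f))"

definition cat_lie :: "(catenoid \<Rightarrow> catenoid) set" where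
  "cat_lie = range cat_comb"


section \<open>The free module of rank 2 and its metrics\<close>

type_synonym cat_module = "catenoid ^ 2"

definition cat_act :: "real \<Rightarrow> cat_module \<Rightarrow> catenoid \<Rightarrow> cat_module" where
  "cat_act hbar X a = (\<chi> i. cat_mult hbar (X $ i) a)"

definition cat_basis :: "2 \<Rightarrow> cat_module" where
  "cat_basis i = axis i 1"

definition cat_form :: "real \<Rightarrow> (2 \<Rightarrow> 2 \<Rightarrow> catenoid) \<Rightarrow> cat_module \<Rightarrow> cat_module \<Rightarrow> catenoid" where
  "cat_form hbar H X Y =
     (\<Sum>i\<in>UNIV. \<Sum>j\<in>UNIV. cat_mult hbar (cat_mult hbar (cat_star hbar (X $ i)) (H i j)) (Y $ j))"

text \<open>
  The real-linear map sending \<open>\<partial>\<^sub>i\<close> to \<open>e\<^sub>i\<close>; it is well defined as \<open>\<partial>\<^sub>1\<close> and \<open>\<partial>\<^sub>2\<close> are linearly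
  independent, see \<open>cat_phi_comb\<close>.
\<close>

definition cat_phi :: "(catenoid \<Rightarrow> catenoid) \<Rightarrow> cat_module" where
  "cat_phi d = (THE X. \<exists>c. d = cat_comb c \<and> X = (\<chi> i. cat_scale (of_real (c $ i)) 1))"

lemma smooth_id: "smooth (\<lambda>u. complex_of_real u)"
  unfolding smooth_iff
proof
  fix n
  show "cdiff n (\<lambda>u. complex_of_real u)"
  proof (cases n)
    case 0
    thus ?thesis by (auto intro!: differentiableI_vector derivative_eq_intros
          has_vector_derivative_of_real)
  next
    case (Suc m)
    show ?thesis unfolding Suc
      by (rule cdiff_SucI[where f' = "\<lambda>_. 1"])
        (use has_vector_derivative_of_real[OF DERIV_ident] cdiff_const in auto)
  qed
qed

lemma inj_cat_comb: "inj cat_comb"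
proof (rule injI)
  fix c c' :: "real ^ 2" assume eq: "cat_comb c = cat_comb c'"
  have lookup: "smooth_apply (Poly_Mapping.lookup (cat_comb c f) n) u
      = of_real (c $ 1) * vderiv (smooth_apply (Poly_Mapping.lookup f n)) u
        + of_real (c $ 2) * (2 * of_real pi * \<i> * of_int n * smooth_apply (Poly_Mapping.lookup f n) u)"
    for c f n u
    by (simp add: cat_comb_def sum_2 cat_deriv_def lookup_add cat_scale.rep_eq cat_deriv1.rep_eq
        cat_deriv2.rep_eq plus_smooth_fun.rep_eq smooth_scale.rep_eq smooth_deriv.rep_eq)
  define f where "f = fun_of_u (Smooth_fun (\<lambda>u. complex_of_real u))"
  have "smooth_apply (Poly_Mapping.lookup f 0) = (\<lambda>u. complex_of_real u)"
    by (simp add: f_def Smooth_fun_inverse smooth_id)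
  moreover have "vderiv (\<lambda>u. complex_of_real u) 0 = 1"
    unfolding vderiv_def using has_vector_derivative_of_real[OF DERIV_ident]
    by (auto intro: vector_derivative_at)
  ultimately have "c $ 1 = c' $ 1"
    using lookup[of c f 0 0] lookup[of c' f 0 0] eq by simp
  moreover have "c $ 2 = c' $ 2"
  proof -
    define g where "g = Poly_Mapping.single (1::int) (1::smooth_fun)"
    have "smooth_apply (Poly_Mapping.lookup g 1) = (\<lambda>_. 1)"
      by (simp add: g_def one_smooth_fun.rep_eq)
    thus ?thesis
      using lookup[of c g 1 0] lookup[of c' g 1 0] eq by (simp add: vderiv_def)
  qed
  ultimately show "c = c'" by (simp add: vec_eq_iff forall_2)
qed

lemma cat_phi_comb: "cat_phi (cat_comb c) = (\<chi> i. cat_scale (of_real (c $ i)) 1)"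
  unfolding cat_phi_def using inj_cat_comb by (auto dest: injD)

lemma cat_comb_axis: "cat_comb (axis k 1) = cat_deriv k"
proof -
  have "cat_scale 1 f = f" "cat_scale 0 f = 0" for f
    by (auto intro!: poly_mapping_eqI simp: cat_scale.rep_eq) (transfer, simp)+
  thus ?thesis
    by (simp add: cat_comb_def axis_def fun_eq_iff if_distrib[of of_real]
        if_distrib[of "\<lambda>z. cat_scale z _"] sum.delta cong: if_cong)
qed

lemma cat_phi_deriv: "cat_phi (cat_deriv k) = cat_basis k"
proof -
  have "cat_scale 1 f = f" "cat_scale 0 f = 0" for f
    by (auto intro!: poly_mapping_eqI simp: cat_scale.rep_eq) (transfer, simp)+
  thus ?thesis
    by (auto simp: cat_comb_axis[symmetric] cat_phi_comb cat_basis_def vec_eq_iff axis_def)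
qed

abbreviation cat_real_metric_calculus :: "real \<Rightarrow> (2 \<Rightarrow> 2 \<Rightarrow> catenoid) \<Rightarrow> bool" where
  "cat_real_metric_calculus hbar H \<equiv>
     real_metric_calculus cat_scale (cat_mult hbar) 1 (cat_star hbar) (cat_act hbar)
       (cat_form hbar H) cat_lie cat_phi"

abbreviation cat_pseudo_riemannian_calculus ::
    "real \<Rightarrow> (2 \<Rightarrow> 2 \<Rightarrow> catenoid) \<Rightarrow> ((catenoid \<Rightarrow> catenoid) \<Rightarrow> cat_module \<Rightarrow> cat_module) \<Rightarrow> bool" where
  "cat_pseudo_riemannian_calculus hbar H D \<equiv>
     pseudo_riemannian_calculus cat_scale (cat_mult hbar) 1 (cat_star hbar) (cat_act hbar)
       (cat_form hbar H) cat_lie cat_phi D"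

definition christoffel ::
    "real \<Rightarrow> (2 \<Rightarrow> 2 \<Rightarrow> catenoid) \<Rightarrow> (2 \<Rightarrow> 2 \<Rightarrow> catenoid) \<Rightarrow> 2 \<Rightarrow> 2 \<Rightarrow> 2 \<Rightarrow> catenoid" where
  "christoffel hbar H Hinv l i j = cat_scale (1/2) (\<Sum>k\<in>UNIV. cat_mult hbar (Hinv l k)
     (cat_deriv i (H j k) + cat_deriv j (H k i) - cat_deriv k (H i j)))"

definition curvature ::
    "((catenoid \<Rightarrow> catenoid) \<Rightarrow> cat_module \<Rightarrow> cat_module) \<Rightarrow> 2 \<Rightarrow> 2 \<Rightarrow> cat_module \<Rightarrow> cat_module" where
  "curvature D i j U = D (cat_deriv i) (D (cat_deriv j) U) - D (cat_deriv j) (D (cat_deriv i) U)"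

definition curvature_coeff ::
    "real \<Rightarrow> (2 \<Rightarrow> 2 \<Rightarrow> catenoid) \<Rightarrow> ((catenoid \<Rightarrow> catenoid) \<Rightarrow> cat_module \<Rightarrow> cat_module)
      \<Rightarrow> 2 \<Rightarrow> 2 \<Rightarrow> 2 \<Rightarrow> 2 \<Rightarrow> catenoid" where
  "curvature_coeff hbar H D i j k l = cat_form hbar H (cat_basis i) (curvature D k l (cat_basis j))"

definition gaussian_curvature ::
    "real \<Rightarrow> (2 \<Rightarrow> 2 \<Rightarrow> catenoid) \<Rightarrow> (2 \<Rightarrow> 2 \<Rightarrow> catenoid)
      \<Rightarrow> ((catenoid \<Rightarrow> catenoid) \<Rightarrow> cat_module \<Rightarrow> cat_module) \<Rightarrow> catenoid" where
  "gaussian_curvature hbar H Hinv D =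
     cat_scale (1/2) (\<Sum>i\<in>UNIV. \<Sum>j\<in>UNIV. \<Sum>k\<in>UNIV. \<Sum>l\<in>UNIV.
       cat_mult hbar (cat_mult hbar (Hinv i j) (curvature_coeff hbar H D i k j l)) (Hinv k l))"

end

theory Submission
  imports Defs
begin

text \<open>
  Although the algebra is noncommutative, a pseudo-Riemannian calculus makes \<open>h (\<nabla>\<^sub>i e\<^sub>j) e\<^sub>k\<close>
  hermitian, hence equal to \<open>h e\<^sub>k (\<nabla>\<^sub>i e\<^sub>j)\<close>, so that the classical cyclic permutation of metric
  compatibility together with vanishing torsion determines it by the Koszul formula; the inverse
  metric then isolates the components of \<open>\<nabla>\<^sub>i e\<^sub>j\<close>. Conversely, arbitrary Christoffel symbols define
  an affine connection on the free module, and metric compatibility only uses that the lowered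
  Christoffel symbols are hermitian and satisfy \<open>\<Gamma>\<^sub>j\<^sub>,\<^sub>i\<^sub>m + \<Gamma>\<^sub>m\<^sub>,\<^sub>i\<^sub>j = \<partial>\<^sub>i h\<^sub>m\<^sub>j\<close>.
\<close>

section \<open>Smooth functions\<close>

lemmas smooth_rep_eq = zero_smooth_fun.rep_eq one_smooth_fun.rep_eq plus_smooth_fun.rep_eq
  times_smooth_fun.rep_eq uminus_smooth_fun.rep_eq minus_smooth_fun.rep_eq smooth_scale.rep_eq
  smooth_cnj.rep_eq smooth_shift.rep_eq smooth_deriv.rep_eq smooth_exp.rep_eq

lemma smooth_fun_eqI: "(\<And>u. smooth_apply f u = smooth_apply g u) \<Longrightarrow> f = g"
  by (simp add: fun_eq_iff flip: smooth_apply_inject)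

lemma smooth_has_vderiv: "(smooth_apply f has_vector_derivative vderiv (smooth_apply f) u) (at u)"
  using smooth_apply[of f] by (auto simp: smooth_iff intro: cdiff_has_vderiv)

lemma smooth_derivI:
  assumes "\<And>u. (smooth_apply f has_vector_derivative smooth_apply g u) (at u)"
  shows "smooth_deriv f = g"
  using assms by (auto intro!: smooth_fun_eqI simp: smooth_rep_eq vderiv_def vector_derivative_at)

lemma smooth_shift_add: "smooth_shift a (f + g) = smooth_shift a f + smooth_shift a g"
  and smooth_shift_mult: "smooth_shift a (f * g) = smooth_shift a f * smooth_shift a g"
  and smooth_shift_shift: "smooth_shift a (smooth_shift b f) = smooth_shift (a + b) f"
  and smooth_shift_0 [simp]: "smooth_shift 0 f = f"
  and smooth_shift_zero [simp]: "smooth_shift a 0 = 0"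
  and smooth_shift_one [simp]: "smooth_shift a 1 = 1"
  and smooth_shift_scale: "smooth_shift a (smooth_scale z f) = smooth_scale z (smooth_shift a f)"
  and smooth_shift_cnj: "smooth_shift a (smooth_cnj f) = smooth_cnj (smooth_shift a f)"
  and smooth_cnj_add: "smooth_cnj (f + g) = smooth_cnj f + smooth_cnj g"
  and smooth_cnj_mult: "smooth_cnj (f * g) = smooth_cnj f * smooth_cnj g"
  and smooth_cnj_zero [simp]: "smooth_cnj 0 = 0"
  and smooth_cnj_one [simp]: "smooth_cnj 1 = 1"
  and smooth_cnj_cnj [simp]: "smooth_cnj (smooth_cnj f) = f"
  and smooth_cnj_scale: "smooth_cnj (smooth_scale z f) = smooth_scale (cnj z) (smooth_cnj f)"
  and smooth_scale_add_left: "smooth_scale (z + w) f = smooth_scale z f + smooth_scale w f"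
  and smooth_scale_add_right: "smooth_scale z (f + g) = smooth_scale z f + smooth_scale z g"
  and smooth_scale_scale: "smooth_scale z (smooth_scale w f) = smooth_scale (z * w) f"
  and smooth_scale_one [simp]: "smooth_scale 1 f = f"
  and smooth_scale_zero_left [simp]: "smooth_scale 0 f = 0"
  and smooth_scale_zero [simp]: "smooth_scale z 0 = 0"
  and smooth_scale_mult_left: "smooth_scale z f * g = smooth_scale z (f * g)"
  and smooth_scale_mult_right: "f * smooth_scale z g = smooth_scale z (f * g)"
  by (rule smooth_fun_eqI; simp add: smooth_rep_eq algebra_simps)+

lemma smooth_deriv_add: "smooth_deriv (f + g) = smooth_deriv f + smooth_deriv g"
  by (rule smooth_derivI)
    (auto simp: smooth_rep_eq intro!: has_vector_derivative_add smooth_has_vderiv)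

lemma smooth_deriv_zero [simp]: "smooth_deriv 0 = 0"
  by (rule smooth_derivI) (simp add: smooth_rep_eq)

lemma smooth_deriv_scale: "smooth_deriv (smooth_scale z f) = smooth_scale z (smooth_deriv f)"
  by (rule smooth_derivI)
    (auto simp: smooth_rep_eq intro!: has_vector_derivative_mult_right smooth_has_vderiv)

lemma smooth_deriv_mult: "smooth_deriv (f * g) = smooth_deriv f * g + f * smooth_deriv g"
proof (rule smooth_derivI)
  fix u
  show "(smooth_apply (f * g) has_vector_derivative
      smooth_apply (smooth_deriv f * g + f * smooth_deriv g) u) (at u)"
    using has_vector_derivative_mult[OF smooth_has_vderiv[of f u] smooth_has_vderiv[of g u]]
    by (simp add: smooth_rep_eq add.commute)
qed

lemma smooth_deriv_shift: "smooth_deriv (smooth_shift a f) = smooth_shift a (smooth_deriv f)"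
proof (rule smooth_derivI)
  fix u
  have "((\<lambda>x::real. x + a) has_vector_derivative 1) (at u)"
    by (auto intro!: derivative_eq_intros)
  from vector_diff_chain_at[OF this smooth_has_vderiv]
  show "(smooth_apply (smooth_shift a f) has_vector_derivative
      smooth_apply (smooth_shift a (smooth_deriv f)) u) (at u)"
    by (simp add: smooth_rep_eq o_def)
qed

lemma smooth_deriv_cnj: "smooth_deriv (smooth_cnj f) = smooth_cnj (smooth_deriv f)"
  by (rule smooth_derivI)
    (auto simp: smooth_rep_eq intro!: bounded_linear.has_vector_derivative[OF bounded_linear_cnj]
      smooth_has_vderiv)

lemma smooth_deriv_exp: "smooth_deriv (smooth_exp f) = smooth_deriv f * smooth_exp f"
proof (rule smooth_derivI)
  fix u
  show "(smooth_apply (smooth_exp f) has_vector_derivative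
      smooth_apply (smooth_deriv f * smooth_exp f) u) (at u)"
    using field_vector_diff_chain_at[OF smooth_has_vderiv DERIV_exp]
    by (simp add: smooth_rep_eq o_def)
qed

lemma smooth_exp_add: "smooth_exp (f + g) = smooth_exp f * smooth_exp g"
  and smooth_exp_zero [simp]: "smooth_exp 0 = 1"
  by (rule smooth_fun_eqI; simp add: smooth_rep_eq exp_add)+

section \<open>The catenoid algebra\<close>

text \<open>Every element is a finite sum of monomials, so an additive identity need only be checked
  on those.\<close>

lemma poly_mapping_single_induct [case_names zero add]:
  assumes "P 0"
    and "\<And>f a b. P f \<Longrightarrow> P (f + Poly_Mapping.single a b)"
  shows "P f"
proof (induction f rule: update_induct)
  case (update f a b)
  have "Poly_Mapping.update a b f = f + Poly_Mapping.single a b"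
    \<comment> \<open>\<open>update(1)\<close> puts \<open>a\<close> outside the keys of
      \<open>f\<close>, so writing a coefficient there is the same as adding it.\<close>
    using update(1)
    by (intro poly_mapping_eqI)
      (auto simp: update.rep_eq lookup_add lookup_single in_keys_iff when_def)
  with assms(2)[OF update(3)] show ?case by simp
qed (rule assms)

text \<open>The support over which \<open>cat_mult\<close> sums varies with the left factor. A
  common finite superset makes several products comparable termwise, as additivity on the left
  requires.\<close>

lemma lookup_cat_mult:
  assumes "finite S" "Poly_Mapping.keys f \<subseteq> S"
  shows "Poly_Mapping.lookup (cat_mult hbar f g) n = (\<Sum>k\<in>S.
    Poly_Mapping.lookup f k * smooth_shift (of_int k * hbar) (Poly_Mapping.lookup g (n - k)))"
  using assms unfolding cat_mult.rep_eq keys.rep_eq by (intro sum.mono_neutral_left) auto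

lemma cat_mult_add_left: "cat_mult hbar (f + g) a = cat_mult hbar f a + cat_mult hbar g a"
proof (rule poly_mapping_eqI)
  fix n
  let ?S = "Poly_Mapping.keys f \<union> Poly_Mapping.keys g"
  show "Poly_Mapping.lookup (cat_mult hbar (f + g) a) n
      = Poly_Mapping.lookup (cat_mult hbar f a + cat_mult hbar g a) n"
    using keys_add[of f g]
    by (simp add: lookup_cat_mult[of ?S] lookup_add algebra_simps sum.distrib)
qed

lemma cat_mult_add_right: "cat_mult hbar a (f + g) = cat_mult hbar a f + cat_mult hbar a g"
  by (rule poly_mapping_eqI)
    (simp add: lookup_cat_mult[of "Poly_Mapping.keys a"] lookup_add smooth_shift_add algebra_simps
      sum.distrib)

lemma cat_mult_zero_left [simp]: "cat_mult hbar 0 a = 0"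
  using cat_mult_add_left[of hbar 0 0 a] by simp

lemma cat_mult_zero_right [simp]: "cat_mult hbar a 0 = 0"
  using cat_mult_add_right[of hbar a 0 0] by simp

lemma cat_mult_single: "cat_mult hbar (Poly_Mapping.single i f) (Poly_Mapping.single j g)
    = Poly_Mapping.single (i + j) (f * smooth_shift (of_int i * hbar) g)"
  by (rule poly_mapping_eqI)
    (auto simp: lookup_cat_mult[of "{i}"] lookup_single when_def)

lemma cat_scale_add_right: "cat_scale z (f + g) = cat_scale z f + cat_scale z g"
  and cat_scale_add_left: "cat_scale (z + w) f = cat_scale z f + cat_scale w f"
  and cat_scale_scale: "cat_scale z (cat_scale w f) = cat_scale (z * w) f"
  and cat_scale_one: "cat_scale 1 f = f"
  by (rule poly_mapping_eqI; simp add: cat_scale.rep_eq lookup_add smooth_scale_add_right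
      smooth_scale_add_left smooth_scale_scale)+

lemma cat_scale_zero [simp]: "cat_scale z 0 = 0"
  by (rule poly_mapping_eqI) (simp add: cat_scale.rep_eq)

lemma cat_star_add: "cat_star hbar (f + g) = cat_star hbar f + cat_star hbar g"
  by (rule poly_mapping_eqI) (simp add: cat_star.rep_eq lookup_add smooth_shift_add smooth_cnj_add)

lemma cat_star_zero [simp]: "cat_star hbar 0 = 0"
  by (rule poly_mapping_eqI) (simp add: cat_star.rep_eq)

lemma cat_scale_single:
  "cat_scale z (Poly_Mapping.single i f) = Poly_Mapping.single i (smooth_scale z f)"
  by (rule poly_mapping_eqI) (simp add: cat_scale.rep_eq lookup_single when_def)

text \<open>The shift in \<open>cat_star\<close> is governed by the new exponent, here
  \<open>- i\<close>; hence the sign.\<close>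

lemma cat_star_single: "cat_star hbar (Poly_Mapping.single i f)
    = Poly_Mapping.single (- i) (smooth_cnj (smooth_shift (- (of_int i * hbar)) f))"
  by (rule poly_mapping_eqI) (auto simp: cat_star.rep_eq lookup_single when_def)

text \<open>Both sides are additive in each argument. On monomials the last coefficient is shifted
  by the first two exponents one after the other on one side, and by their sum on the other.\<close>

lemma cat_mult_assoc: "cat_mult hbar (cat_mult hbar a b) c = cat_mult hbar a (cat_mult hbar b c)"
proof (induction a rule: poly_mapping_single_induct)
  case (add a i f)
  have "cat_mult hbar (cat_mult hbar (Poly_Mapping.single i f) b) c
      = cat_mult hbar (Poly_Mapping.single i f) (cat_mult hbar b c)"
  proof (induction b rule: poly_mapping_single_induct)
    case (add b j g)
    have "cat_mult hbar (cat_mult hbar (Poly_Mapping.single i f) (Poly_Mapping.single j g)) c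
      = cat_mult hbar (Poly_Mapping.single i f) (cat_mult hbar (Poly_Mapping.single j g) c)"
      by (induction c rule: poly_mapping_single_induct)
        (simp_all add: cat_mult_add_right cat_mult_single smooth_shift_mult smooth_shift_shift
          algebra_simps)
    with add show ?case by (simp add: cat_mult_add_left cat_mult_add_right)
  qed simp
  with add show ?case by (simp add: cat_mult_add_left)
qed simp

text \<open>The two-variable form of the monomial induction, meant for biadditive
  identities.\<close>

lemma cat_mult_single_induct:
  assumes add1: "\<And>a a' b. P a b \<Longrightarrow> P a' b \<Longrightarrow> P (a + a') b"
    and add2: "\<And>a b b'. P a b \<Longrightarrow> P a b' \<Longrightarrow> P a (b + b')"
    and zero: "\<And>b. P 0 b" "\<And>a. P a 0"
    and single: "\<And>i f j g. P (Poly_Mapping.single i f) (Poly_Mapping.single j g)"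
  shows "P a b"
proof (induction a rule: poly_mapping_single_induct)
  case (add a i f)
  have "P (Poly_Mapping.single i f) b"
    by (induction b rule: poly_mapping_single_induct) (auto intro: zero add2 single)
  with add show ?case by (rule add1)
qed (rule zero)

text \<open>On monomials both sides have exponent -(i + j) and coefficient cnj f(u - (i + j) hbar)
  cnj g(u - j hbar).\<close>

lemma cat_star_mult:
  "cat_star hbar (cat_mult hbar a b) = cat_mult hbar (cat_star hbar b) (cat_star hbar a)"
  by (induction a b rule: cat_mult_single_induct)
    (simp_all add: cat_mult_add_left cat_mult_add_right cat_star_add cat_mult_single cat_star_single
      smooth_shift_mult smooth_cnj_mult smooth_shift_shift smooth_shift_cnj algebra_simps)

global_interpretation cat: star_algebra cat_scale "cat_mult hbar" 1 "cat_star hbar" for hbar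
proof (unfold_locales)
  fix a b :: catenoid and z :: complex
  show "cat_mult hbar (cat_scale z a) b = cat_scale z (cat_mult hbar a b)"
    by (induction a b rule: cat_mult_single_induct)
      (simp_all add: cat_mult_add_left cat_mult_add_right cat_scale_add_right cat_mult_single
        cat_scale_single smooth_scale_mult_left)
  show "cat_mult hbar a (cat_scale z b) = cat_scale z (cat_mult hbar a b)"
    by (induction a b rule: cat_mult_single_induct)
      (simp_all add: cat_mult_add_left cat_mult_add_right cat_scale_add_right cat_mult_single
        cat_scale_single smooth_scale_mult_right smooth_shift_scale)
  show "cat_mult hbar 1 a = a"
    by (induction a rule: poly_mapping_single_induct)
      (simp_all add: cat_mult_add_right cat_mult_single flip: single_one)
  show "cat_mult hbar a 1 = a"
    by (induction a rule: poly_mapping_single_induct)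
      (simp_all add: cat_mult_add_left cat_mult_single flip: single_one)
  show "cat_star hbar (cat_scale z a) = cat_scale (cnj z) (cat_star hbar a)"
    by (rule poly_mapping_eqI)
      (simp add: cat_scale.rep_eq cat_star.rep_eq smooth_shift_scale smooth_cnj_scale)
  show "cat_star hbar (cat_star hbar a) = a"
    by (rule poly_mapping_eqI)
      (simp add: cat_star.rep_eq smooth_shift_cnj smooth_shift_shift)
qed (simp_all add: cat_mult_add_left cat_mult_add_right cat_mult_assoc cat_star_add cat_star_mult
    cat_scale_add_left cat_scale_add_right cat_scale_scale cat_scale_one)

section \<open>The two basic derivations\<close>

lemma cat_deriv_single: "cat_deriv i (Poly_Mapping.single n f) = Poly_Mapping.single n
    (if i = 1 then smooth_deriv f else smooth_scale (2 * of_real pi * \<i> * of_int n) f)"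
  by (rule poly_mapping_eqI)
    (auto simp: cat_deriv_def cat_deriv1.rep_eq cat_deriv2.rep_eq lookup_single when_def)

lemma cat_deriv_add: "cat_deriv i (f + g) = cat_deriv i f + cat_deriv i g"
  by (rule poly_mapping_eqI) (simp add: cat_deriv_def cat_deriv1.rep_eq cat_deriv2.rep_eq lookup_add
      smooth_deriv_add smooth_scale_add_right)

lemma cat_deriv_zero [simp]: "cat_deriv i 0 = 0"
  using cat_deriv_add[of i 0 0] by simp

lemma cat_deriv_scale: "cat_deriv i (cat_scale z f) = cat_scale z (cat_deriv i f)"
  by (rule poly_mapping_eqI) (simp add: cat_deriv_def cat_deriv1.rep_eq cat_deriv2.rep_eq
      cat_scale.rep_eq smooth_deriv_scale smooth_scale_scale mult.commute)

text \<open>On monomials, the rule for \<open>cat_deriv1\<close> holds because differentiation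
  commutes with the shift, and the rule for \<open>cat_deriv2\<close> because exponents add.\<close>

lemma cat_deriv_mult:
  "cat_deriv i (cat_mult hbar a b) = cat_mult hbar (cat_deriv i a) b + cat_mult hbar a (cat_deriv i b)"
  by (induction a b rule: cat_mult_single_induct)
    (simp_all add: cat_mult_add_left cat_mult_add_right cat_deriv_add cat_mult_single cat_deriv_single
      smooth_deriv_mult smooth_deriv_shift smooth_shift_scale smooth_scale_mult_left
      smooth_scale_mult_right algebra_simps flip: single_add smooth_scale_add_left)

text \<open>For \<open>cat_deriv2\<close>, conjugation reverses the sign of the imaginary unit and
  the star that of the exponent, so the factor 2 pi i n survives.\<close>

lemma cat_deriv_star: "cat_star hbar (cat_deriv i a) = cat_deriv i (cat_star hbar a)"
  by (rule poly_mapping_eqI) (simp add: cat_deriv_def cat_deriv1.rep_eq cat_deriv2.rep_eq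
      cat_star.rep_eq smooth_deriv_cnj smooth_deriv_shift smooth_shift_scale smooth_cnj_scale)

lemma cat_deriv_commute: "cat_deriv i (cat_deriv j f) = cat_deriv j (cat_deriv i f)"
  by (rule poly_mapping_eqI) (simp add: cat_deriv_def cat_deriv1.rep_eq cat_deriv2.rep_eq
      smooth_deriv_scale)

section \<open>The Koszul formula\<close>

context pseudo_riemannian_calculus
begin

lemma h_diff_right: "h U (V - W) = h U V - h U W"
  using h_add_right[of U "V - W" W] by (simp add: algebra_simps)

lemma connection_swap:
  assumes "d \<in> g" "E \<in> \<phi> ` g" "E' \<in> \<phi> ` g"
  shows "h (D d E) E' = h E' (D d E)"
  using connection_real[OF assms] by (simp add: h_star)

text \<open>Compatibility and vanishing torsion rewrite every term on the right as a pairing of some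
  \<open>\<phi> d\<close> with a covariant derivative of another \<open>\<phi> d'\<close>. These
  cancel in pairs except for two copies of the pairing on the left.\<close>

lemma koszul:
  assumes "d1 \<in> g" "d2 \<in> g" "d3 \<in> g"
  shows "scale 2 (h (\<phi> d3) (D d1 (\<phi> d2))) =
    d1 (h (\<phi> d2) (\<phi> d3)) + d2 (h (\<phi> d3) (\<phi> d1)) - d3 (h (\<phi> d1) (\<phi> d2))
    - h (\<phi> d1) (\<phi> (commutator d2 d3)) - h (\<phi> d2) (\<phi> (commutator d1 d3))
    + h (\<phi> d3) (\<phi> (commutator d1 d2))"
proof -
  have metric: "d (h (\<phi> d') (\<phi> d'')) = h (\<phi> d'') (D d (\<phi> d')) + h (\<phi> d') (D d (\<phi> d''))"
    if "d \<in> g" "d' \<in> g" "d'' \<in> g" for d d' d''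
    using that by (simp add: connection_metric connection_swap)
  have torsion: "h (\<phi> d'') (\<phi> (commutator d d'))
      = h (\<phi> d'') (D d (\<phi> d')) - h (\<phi> d'') (D d' (\<phi> d))"
    if "d \<in> g" "d' \<in> g" for d d' d''
    using torsion_free[OF that] by (simp flip: h_diff_right)
  have "scale 2 x = x + x" for x
    using scale_left_distrib[of 1 1 x] by simp
  with assms show ?thesis by (simp add: metric torsion)
qed

end

section \<open>The free module and its connections\<close>

lemma cat_scale_half: "cat_scale (1/2) (a + a) = a"
  unfolding cat_scale_add_right cat_scale_add_left[symmetric] by (simp add: cat_scale_one)

lemma cat_mult_minus_right: "cat_mult hbar a (- b) = - cat_mult hbar a b"
  using cat_mult_add_right[of hbar a "- b" b] by (simp add: eq_neg_iff_add_eq_0)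

lemma cat_mult_minus_left: "cat_mult hbar (- a) b = - cat_mult hbar a b"
  using cat_mult_add_left[of hbar "- a" a b] by (simp add: eq_neg_iff_add_eq_0)

lemma cat_deriv_minus: "cat_deriv i (- a) = - cat_deriv i a"
  using cat_deriv_add[of i "- a" a] by (simp add: eq_neg_iff_add_eq_0)

lemma cat_mult_sum_left: "cat_mult hbar (sum f S) b = (\<Sum>x\<in>S. cat_mult hbar (f x) b)"
  by (induction S rule: infinite_finite_induct) (simp_all add: cat_mult_add_left)

lemma cat_mult_sum_right: "cat_mult hbar b (sum f S) = (\<Sum>x\<in>S. cat_mult hbar b (f x))"
  by (induction S rule: infinite_finite_induct) (simp_all add: cat_mult_add_right)

lemma cat_star_sum: "cat_star hbar (sum f S) = (\<Sum>x\<in>S. cat_star hbar (f x))"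
  by (induction S rule: infinite_finite_induct) (simp_all add: cat_star_add)

lemma cat_star_unit [simp]: "cat_star hbar 1 = 1"
  by (simp add: cat_star_single flip: single_one)

lemma cat_deriv_unit [simp]: "cat_deriv i 1 = 0"
  \<comment> \<open>The unit is the same for every \<open>hbar\<close>, so the Leibniz rule for the
    square of \<open>1\<close> may be taken at \<open>hbar = 0\<close>.\<close>
  using cat_deriv_mult[of i 0 1 1] by (simp add: cat.mult_unit_left cat.mult_unit_right)

section \<open>The abelian Lie algebra of real combinations\<close>

lemma cat_comb_2: "cat_comb c f =
    cat_scale (of_real (c $ 1)) (cat_deriv 1 f) + cat_scale (of_real (c $ 2)) (cat_deriv 2 f)"
  by (simp add: cat_comb_def sum_2)

lemma cat_comb_add: "cat_comb c (a + b) = cat_comb c a + cat_comb c b"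
  by (simp add: cat_comb_2 cat_deriv_add cat_scale_add_right)

lemma cat_comb_zero [simp]: "cat_comb c 0 = 0"
  by (simp add: cat_comb_2)

lemma cat_comb_sum: "cat_comb c (sum f S) = (\<Sum>x\<in>S. cat_comb c (f x))"
  by (induction S rule: infinite_finite_induct) (simp_all add: cat_comb_add)

lemma cat_comb_scale: "cat_comb c (cat_scale z a) = cat_scale z (cat_comb c a)"
  by (simp add: cat_comb_2 cat_deriv_scale cat_scale_add_right cat_scale_scale mult.commute)

lemma cat_comb_mult:
  "cat_comb c (cat_mult hbar a b) = cat_mult hbar (cat_comb c a) b + cat_mult hbar a (cat_comb c b)"
  by (simp add: cat_comb_2 cat_deriv_mult cat_scale_add_right cat_mult_add_left cat_mult_add_right
      cat.mult_scale_left cat.mult_scale_right)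

lemma cat_comb_star: "cat_star hbar (cat_comb c a) = cat_comb c (cat_star hbar a)"
  by (simp add: cat_comb_2 cat_star_add cat.star_scale cat_deriv_star)

lemma cat_comb_commute: "cat_comb c (cat_comb c' a) = cat_comb c' (cat_comb c a)"
  by (simp add: cat_comb_2 cat_deriv_add cat_deriv_scale cat_scale_add_right cat_scale_scale
      cat_deriv_commute[of 2 1] algebra_simps)

lemma cat_comb_lincomb:
  "cat_comb (r *\<^sub>R c + c') a = cat_scale (of_real r) (cat_comb c a) + cat_comb c' a"
  by (simp add: cat_comb_2 cat_scale_add_right cat_scale_add_left cat_scale_scale algebra_simps)

lemma real_lincomb_cat_comb:
  "cat.real_lincomb r (cat_comb c) (cat_comb c') = cat_comb (r *\<^sub>R c + c')"
  by (simp add: fun_eq_iff cat.real_lincomb_def cat_comb_lincomb)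

lemma cat_comb_0: "cat_comb 0 = (\<lambda>_. 0)"
  by (simp add: fun_eq_iff cat_comb_2)

text \<open>Writing the zero derivation as \<open>cat_comb 0\<close> exhibits it as a member of
  \<open>cat_lie\<close> and lets \<open>cat_phi\<close> be evaluated on it.\<close>

lemma commutator_cat_comb: "cat.commutator (cat_comb c) (cat_comb c') = cat_comb 0"
  by (simp add: cat.commutator_def cat_comb_commute[of c c'] cat_comb_0)

lemma cat_lie_algebra: "cat.lie_algebra_of_hermitian_derivations hbar cat_lie"
  unfolding cat.lie_algebra_of_hermitian_derivations_def cat.hermitian_derivation_def
    cat.derivation_def cat_lie_def
  by (auto simp: cat_comb_add cat_comb_scale cat_comb_mult cat_comb_star real_lincomb_cat_comb
      commutator_cat_comb simp flip: cat_comb_0)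

lemma cat_deriv_in_lie: "cat_deriv i \<in> cat_lie"
  by (simp add: cat_lie_def flip: cat_comb_axis)

section \<open>The free module and its hermitian form\<close>

global_interpretation cat:
  right_module cat_scale "cat_mult hbar" 1 "cat_star hbar" "cat_act hbar" for hbar
  by unfold_locales (simp_all add: vec_eq_iff cat_act_def cat_mult_add_left cat_mult_add_right
      cat_mult_assoc cat.mult_unit_right)

lemma cat_act_nth [simp]: "cat_act hbar U a $ l = cat_mult hbar (U $ l) a"
  by (simp add: cat_act_def)

lemma cat_real_scale_nth [simp]: "cat.real_scale hbar r U $ l = cat_scale (of_real r) (U $ l)"
  by (simp add: cat.real_scale_def cat.mult_scale_right cat.mult_unit_right)

lemma cat_basis_nth: "cat_basis i $ j = (if i = j then 1 else 0)"
  by (simp add: cat_basis_def axis_def)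

lemma cat_basis_expansion: "U = (\<Sum>i\<in>UNIV. cat_act hbar (cat_basis i) (U $ i))"
  by (simp add: vec_eq_iff forall_2 sum_2 cat_basis_nth cat.mult_unit_left)

lemma cat_form_add_right: "cat_form hbar H U (V + W) = cat_form hbar H U V + cat_form hbar H U W"
  by (simp add: cat_form_def cat_mult_add_right sum.distrib)

lemma cat_form_add_left: "cat_form hbar H (U + V) W = cat_form hbar H U W + cat_form hbar H V W"
  by (simp add: cat_form_def cat_mult_add_left cat_star_add sum.distrib)

lemma cat_form_act_right:
  "cat_form hbar H U (cat_act hbar V a) = cat_mult hbar (cat_form hbar H U V) a"
  by (simp add: cat_form_def cat_mult_sum_left cat_mult_assoc)

lemma cat_form_star:
  assumes "\<And>i j. cat_star hbar (H i j) = H j i"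
  shows "cat_star hbar (cat_form hbar H U V) = cat_form hbar H V U"
  by (simp add: cat_form_def cat_star_sum cat_star_mult cat.star_star assms cat_mult_assoc)
    (rule sum.swap)

text \<open>Pairing with basis vectors lowers an index.\<close>

lemma cat_form_basis_left:
  "cat_form hbar H (cat_basis k) Y = (\<Sum>l\<in>UNIV. cat_mult hbar (H k l) (Y $ l))"
proof -
  have "(\<Sum>j\<in>UNIV. cat_mult hbar (cat_mult hbar (cat_star hbar (cat_basis k $ i)) (H i j)) (Y $ j))
     = (if i = k then (\<Sum>l\<in>UNIV. cat_mult hbar (H k l) (Y $ l)) else 0)" for i
    by (simp add: cat_basis_nth cat.mult_unit_left)
  then show ?thesis by (simp add: cat_form_def)
qed

text \<open>Raising the index with a left inverse of the metric recovers the components. Both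
  nondegeneracy and the uniqueness of the connection rest on this.\<close>

lemma cat_component_from_form:
  assumes "\<And>i k. (\<Sum>j\<in>UNIV. cat_mult hbar (Hinv i j) (H j k)) = (if i = k then 1 else 0)"
  shows "Y $ l = (\<Sum>k\<in>UNIV. cat_mult hbar (Hinv l k) (cat_form hbar H (cat_basis k) Y))"
proof -
  have "(\<Sum>k\<in>UNIV. cat_mult hbar (Hinv l k) (cat_form hbar H (cat_basis k) Y))
      = (\<Sum>m\<in>UNIV. \<Sum>k\<in>UNIV. cat_mult hbar (cat_mult hbar (Hinv l k) (H k m)) (Y $ m))"
    unfolding cat_form_basis_left cat_mult_sum_right cat_mult_assoc by (rule sum.swap)
  also have "\<dots> = (\<Sum>m\<in>UNIV. if l = m then Y $ m else 0)"
    unfolding cat_mult_sum_left[symmetric] assms by (intro sum.cong) (auto simp: cat.mult_unit_left)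
  finally show ?thesis by simp
qed

text \<open>The star moves \<open>U\<close> into the right slot, where its components can be
  recovered from the pairings.\<close>

lemma cat_form_nondegenerate:
  assumes star: "\<And>i j. cat_star hbar (H i j) = H j i"
    and inv: "\<And>i k. (\<Sum>j\<in>UNIV. cat_mult hbar (Hinv i j) (H j k)) = (if i = k then 1 else 0)"
    and zero: "\<And>V. cat_form hbar H U V = 0"
  shows "U = 0"
proof -
  have "cat_form hbar H V U = 0" for V
    using cat_form_star[of hbar H U V, OF star] zero[of V] by simp
  then show ?thesis
    by (simp add: vec_eq_iff cat_component_from_form[OF inv, of U])
qed

lemma cat_form_real_scale_right:
  "cat_form hbar H U (cat.real_scale hbar r V) = cat_scale (of_real r) (cat_form hbar H U V)"
  by (simp add: cat.real_scale_def cat_form_act_right cat.mult_scale_right cat.mult_unit_right)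

lemma cat_form_real_scale_left:
  "cat_form hbar H (cat.real_scale hbar r U) V = cat_scale (of_real r) (cat_form hbar H U V)"
  by (simp add: cat_form_def cat.star_scale cat.mult_scale_left cat.scale_sum_right)

lemma cat_form_basis: "cat_form hbar H (cat_basis i) (cat_basis j) = H i j"
  by (simp add: cat_form_basis_left cat_basis_nth if_distrib[of "cat_mult hbar _"]
      cat.mult_unit_right cong: if_cong)

lemma cat_phi_comb_basis: "cat_phi (cat_comb c) =
    cat.real_scale hbar (c $ 1) (cat_basis 1) + cat.real_scale hbar (c $ 2) (cat_basis 2)"
  by (simp add: cat_phi_comb vec_eq_iff forall_2 cat_basis_nth)

lemma cat_real_metric_calculus:
  assumes star: "\<And>i j. cat_star hbar (H i j) = H j i"
    and sym: "\<And>i j. H j i = H i j"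
    and inv: "\<And>i k. (\<Sum>j\<in>UNIV. cat_mult hbar (Hinv i j) (H j k)) = (if i = k then 1 else 0)"
  shows "cat_real_metric_calculus hbar H"
proof unfold_locales
  fix U V W :: cat_module and a d d' r E E'
  show "cat_form hbar H U (V + W) = cat_form hbar H U V + cat_form hbar H U W"
    by (rule cat_form_add_right)
  show "cat_form hbar H U (cat_act hbar V a) = cat_mult hbar (cat_form hbar H U V) a"
    by (rule cat_form_act_right)
  show "cat_star hbar (cat_form hbar H U V) = cat_form hbar H V U"
    by (rule cat_form_star[OF star])
  show "cat.lie_algebra_of_hermitian_derivations hbar cat_lie"
    by (rule cat_lie_algebra)
  show "U = 0" if "\<And>V. cat_form hbar H U V = 0"
    by (rule cat_form_nondegenerate[OF star inv that])
  show "cat_phi (cat.real_lincomb r d d') = cat.real_scale hbar r (cat_phi d) + cat_phi d'"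
    if "d \<in> cat_lie" "d' \<in> cat_lie"
    using that by (auto simp: cat_lie_def real_lincomb_cat_comb cat_phi_comb vec_eq_iff
        cat_scale_add_left cat_scale_scale)
  show "cat.submodule hbar hull (cat_phi ` cat_lie) = UNIV"
  proof -
    have "U \<in> N" if N: "cat.submodule hbar N" "cat_phi ` cat_lie \<subseteq> N" for U N
    proof -
      have "cat_basis i \<in> N" for i
        using N(2) cat_deriv_in_lie cat_phi_deriv by (metis image_subset_iff)
      then show ?thesis
        using N(1) by (subst cat_basis_expansion[of U hbar]) (auto simp: cat.submodule_def sum_2)
    qed
    then show ?thesis by (auto simp: hull_def)
  qed
  show "cat_star hbar (cat_form hbar H E E') = cat_form hbar H E E'"
    if "E \<in> cat_phi ` cat_lie" "E' \<in> cat_phi ` cat_lie"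
    \<comment> \<open>By \<open>cat_form_star\<close> the goal is symmetry of the form. On real
      combinations of the basis vectors this reduces to equality of the two off-diagonal entries of
      \<open>H\<close>.\<close>
    using that sym[of 1 2]
    by (auto simp: cat_lie_def cat_form_star[OF star] cat_phi_comb_basis[of _ hbar]
        cat_form_add_left cat_form_add_right cat_form_real_scale_left cat_form_real_scale_right
        cat_form_basis cat_scale_add_right cat_scale_scale algebra_simps)
qed

section \<open>Affine connections in coordinates\<close>

text \<open>
  The components of \<open>d\<close> with respect to \<open>\<partial>\<^sub>1, \<partial>\<^sub>2\<close> are \<open>inv cat_comb d\<close>; for \<open>d \<notin> cat_lie\<close> they, and
  hence the value below, are junk.
\<close>

definition cat_connection ::
    "real \<Rightarrow> (2 \<Rightarrow> 2 \<Rightarrow> 2 \<Rightarrow> catenoid) \<Rightarrow> (catenoid \<Rightarrow> catenoid) \<Rightarrow> cat_module \<Rightarrow> cat_module" where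
  "cat_connection hbar G d U = (\<chi> l. d (U $ l) + (\<Sum>m\<in>UNIV. cat_mult hbar
     (\<Sum>i\<in>UNIV. cat_scale (of_real (inv cat_comb d $ i)) (G l i m)) (U $ m)))"

lemma cat_connection_comb: "cat_connection hbar G (cat_comb c) U = (\<chi> l. cat_comb c (U $ l) +
    (\<Sum>m\<in>UNIV. cat_mult hbar (\<Sum>i\<in>UNIV. cat_scale (of_real (c $ i)) (G l i m)) (U $ m)))"
  by (simp add: cat_connection_def inj_cat_comb)

lemma cat_connection_deriv: "cat_connection hbar G (cat_deriv i) U $ l =
    cat_deriv i (U $ l) + (\<Sum>m\<in>UNIV. cat_mult hbar (G l i m) (U $ m))"
proof -
  have "(\<Sum>k\<in>UNIV. cat_scale (of_real (axis i 1 $ k)) (G l k m)) = G l i m" for m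
    by (cases i rule: exhaust_2[THEN disjE]) (simp_all add: sum_2 axis_def cat_scale_one)
  then show ?thesis
    by (simp add: cat_connection_comb flip: cat_comb_axis)
qed

text \<open>The symbols multiply from the left, so their contribution is right linear; the Leibniz
  term comes from differentiating the components.\<close>

lemma affine_connection_cat_connection: "cat.affine_connection hbar cat_lie (cat_connection hbar G)"
  unfolding cat.affine_connection_def cat_lie_def
  by (auto simp: real_lincomb_cat_comb cat_connection_comb vec_eq_iff sum_2 cat_comb_add
      cat_comb_lincomb cat_comb_mult cat_mult_add_left cat_mult_add_right cat.mult_scale_left
      cat_scale_add_left cat_scale_add_right cat_scale_scale cat_mult_assoc)

text \<open>On a free module, additivity and the Leibniz rule reduce a connection to the basis
  vectors, and linearity in the direction reduces it to the two basic derivations.\<close>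

lemma affine_connection_eq_cat_connection:
  assumes D: "cat.affine_connection hbar cat_lie D" and "d \<in> cat_lie"
  shows "D d U = cat_connection hbar (\<lambda>l i j. D (cat_deriv i) (cat_basis j) $ l) d U"
proof -
  obtain c where d: "d = cat_comb c" using assms(2) by (auto simp: cat_lie_def)
  have add: "D (cat_comb c) (U + V) = D (cat_comb c) U + D (cat_comb c) V"
    and act: "D (cat_comb c) (cat_act hbar U a)
      = cat_act hbar (D (cat_comb c) U) a + cat_act hbar U (cat_comb c a)"
    and lin: "D (cat_comb (r *\<^sub>R c + c')) U =
      cat.real_scale hbar r (D (cat_comb c) U) + D (cat_comb c') U"
    for c c' r U V a
    using D by (auto simp: cat.affine_connection_def cat_lie_def simp flip: real_lincomb_cat_comb)
  have zero: "D (cat_comb 0) U = 0" for U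
    \<comment> \<open>This instance reads
      \<open>D (cat_comb 0) U = D (cat_comb 0) U + D (cat_comb 0) U\<close>.\<close>
    using lin[of 1 0 0 U] by (simp add: vec_eq_iff cat_scale_one)
  \<comment> \<open>The trailing zero gives both summands the shape of \<open>lin\<close>, which is
    then applied twice.\<close>
  have "c = (c $ 1) *\<^sub>R axis 1 1 + ((c $ 2) *\<^sub>R axis 2 1 + 0)"
    by (simp add: vec_eq_iff forall_2 axis_def)
  then have comb: "D (cat_comb c) V =
      cat.real_scale hbar (c $ 1) (D (cat_deriv 1) V)
      + cat.real_scale hbar (c $ 2) (D (cat_deriv 2) V)" for V
    by (metis lin zero cat_comb_axis add.right_neutral)
  have "D (cat_comb c) U = D (cat_comb c) (\<Sum>i\<in>UNIV. cat_act hbar (cat_basis i) (U $ i))"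
    by (simp flip: cat_basis_expansion)
  also have "\<dots> = (\<Sum>i\<in>UNIV. cat_act hbar (D (cat_comb c) (cat_basis i)) (U $ i)
      + cat_act hbar (cat_basis i) (cat_comb c (U $ i)))"
    by (simp add: sum_2 add act)
  finally show ?thesis
    unfolding d comb cat_connection_comb
    by (simp add: vec_eq_iff forall_2 sum_2 cat_basis_nth cat.mult_unit_left algebra_simps)
qed

section \<open>The Levi-Civita connection\<close>

text \<open>The Christoffel symbols of the first kind, with \<open>k\<close> the lowered index. They
  contain no products in the algebra, so the star acts on them term by term.\<close>

definition christoffel_lower :: "(2 \<Rightarrow> 2 \<Rightarrow> catenoid) \<Rightarrow> 2 \<Rightarrow> 2 \<Rightarrow> 2 \<Rightarrow> catenoid" where
  "christoffel_lower H k i j =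
     cat_scale (1/2) (cat_deriv i (H j k) + cat_deriv j (H k i) - cat_deriv k (H i j))"

lemma christoffel_eq_lower:
  "christoffel hbar H Hinv l i j = (\<Sum>k\<in>UNIV. cat_mult hbar (Hinv l k) (christoffel_lower H k i j))"
  by (simp add: christoffel_def christoffel_lower_def cat.scale_sum_right cat.mult_scale_right)

text \<open>Lowering undoes raising. Here the inverse stands to the right of the metric, whereas
  \<open>cat_component_from_form\<close> has it on the left.\<close>

lemma christoffel_lower_eq:
  assumes inv: "\<And>i k. (\<Sum>j\<in>UNIV. cat_mult hbar (H k j) (Hinv j i)) = (if i = k then 1 else 0)"
  shows "(\<Sum>l\<in>UNIV. cat_mult hbar (H k l) (christoffel hbar H Hinv l i j)) = christoffel_lower H k i j"
proof -
  have "(\<Sum>l\<in>UNIV. cat_mult hbar (H k l) (christoffel hbar H Hinv l i j)) =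
      (\<Sum>m\<in>UNIV. \<Sum>l\<in>UNIV.
        cat_mult hbar (cat_mult hbar (H k l) (Hinv l m)) (christoffel_lower H m i j))"
    unfolding christoffel_eq_lower cat_mult_sum_right cat_mult_assoc by (rule sum.swap)
  also have "\<dots> = (\<Sum>m\<in>UNIV. if m = k then christoffel_lower H m i j else 0)"
    unfolding cat_mult_sum_left[symmetric] inv by (intro sum.cong) (auto simp: cat.mult_unit_left)
  finally show ?thesis by simp
qed

lemma cat_star_diff: "cat_star hbar (a - b) = cat_star hbar a - cat_star hbar b"
  using cat_star_add[of hbar "a - b" b] by (simp add: algebra_simps)

text \<open>Symmetry makes each single entry of \<open>H\<close> hermitian; the derivations are
  hermitian and the factor one half is real.\<close>

lemma christoffel_lower_star:
  assumes star: "\<And>i j. cat_star hbar (H i j) = H j i"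
    and sym: "\<And>i j. H j i = H i j"
  shows "cat_star hbar (christoffel_lower H k i j) = christoffel_lower H k i j"
proof -
  have "cat_star hbar (H i j) = H i j" for i j
    using star sym by metis
  then show ?thesis
    by (simp add: christoffel_lower_def cat.star_scale cat_star_add cat_star_diff cat_deriv_star)
qed

text \<open>By symmetry of \<open>H\<close> the derivatives along \<open>j\<close> and
  \<open>m\<close> cancel, leaving two halves of the derivative along \<open>i\<close>.\<close>

lemma christoffel_lower_metric:
  assumes sym: "\<And>i j. H j i = H i j"
  shows "christoffel_lower H j i m + christoffel_lower H m i j = cat_deriv i (H m j)"
  using cat_scale_half[of "cat_deriv i (H m j)"]
  by (simp add: christoffel_lower_def sym[of i m] sym[of i j] sym[of j m] flip: cat_scale_add_right)

lemma christoffel_sym: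
  assumes sym: "\<And>i j. H j i = H i j"
  shows "christoffel hbar H Hinv l i j = christoffel hbar H Hinv l j i"
proof -
  have "christoffel_lower H k i j = christoffel_lower H k j i" for k
    using sym[of i j] sym[of i k] sym[of j k] by (simp add: christoffel_lower_def algebra_simps)
  then show ?thesis by (simp add: christoffel_eq_lower)
qed

section \<open>Metric compatibility\<close>

lemma cat_comb_form:
  "cat_comb c (cat_form hbar H U V) =
     cat_form hbar H (\<chi> l. cat_comb c (U $ l)) V + cat_form hbar H U (\<chi> l. cat_comb c (V $ l))
     + cat_form hbar (\<lambda>i j. cat_comb c (H i j)) U V"
  by (simp add: cat_form_def cat_comb_sum cat_comb_mult cat_comb_star cat_mult_add_left sum.distrib)

text \<open>Absorbing a coefficient matrix into the Gram matrix turns metric compatibility into an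
  identity of matrices. This is why \<open>cat_form\<close> is used with matrices that need not be
  metrics.\<close>

lemma cat_form_matrix_right:
  "cat_form hbar H U (\<chi> l. \<Sum>m\<in>UNIV. cat_mult hbar (G l m) (V $ m)) =
     cat_form hbar (\<lambda>i j. \<Sum>l\<in>UNIV. cat_mult hbar (H i l) (G l j)) U V"
  by (simp add: cat_form_def sum_2 cat_mult_add_left cat_mult_add_right cat_mult_assoc)

lemma cat_form_matrix_left:
  "cat_form hbar H (\<chi> l. \<Sum>m\<in>UNIV. cat_mult hbar (G l m) (U $ m)) V =
     cat_form hbar (\<lambda>i j. \<Sum>l\<in>UNIV. cat_mult hbar (cat_star hbar (G l i)) (H l j)) U V"
  by (simp add: cat_form_def sum_2 cat_mult_add_left cat_mult_add_right cat_mult_assoc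
      cat_star_add cat_star_mult)

lemma cat_form_add_matrix:
  "cat_form hbar H U V + cat_form hbar H' U V = cat_form hbar (\<lambda>i j. H i j + H' i j) U V"
  by (simp add: cat_form_def cat_mult_add_left cat_mult_add_right sum.distrib)

text \<open>After expansion by the Leibniz rule, what remains is that the derivative of
  \<open>H\<close> is the lowered connection matrix plus its transpose.\<close>

lemma cat_connection_metric:
  assumes star: "\<And>i j. cat_star hbar (H i j) = H j i"
    and sym: "\<And>i j. H j i = H i j"
    and inv: "\<And>i k. (\<Sum>j\<in>UNIV. cat_mult hbar (H k j) (Hinv j i)) = (if i = k then 1 else 0)"
    and d: "d \<in> cat_lie"
  defines "D \<equiv> cat_connection hbar (christoffel hbar H Hinv)"
  shows "d (cat_form hbar H U V) = cat_form hbar H (D d U) V + cat_form hbar H U (D d V)"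
proof -
  obtain c where c: "d = cat_comb c" using d by (auto simp: cat_lie_def)
  \<comment> \<open>\<open>G\<close> is the connection matrix in the direction \<open>c\<close>, and
    \<open>L\<close> will be the result of lowering its first index.\<close>
  define G where "G l m = (\<Sum>i\<in>UNIV. cat_scale (of_real (c $ i)) (christoffel hbar H Hinv l i m))" for l m
  define L where "L k m = (\<Sum>i\<in>UNIV. cat_scale (of_real (c $ i)) (christoffel_lower H k i m))" for k m
  have D: "D d U = (\<chi> l. d (U $ l)) + (\<chi> l. \<Sum>m\<in>UNIV. cat_mult hbar (G l m) (U $ m))" for U
    by (simp add: D_def c cat_connection_comb G_def vec_eq_iff)
  have lower: "(\<Sum>l\<in>UNIV. cat_mult hbar (H i l) (G l j)) = L i j" for i j
    unfolding G_def L_def christoffel_lower_eq[OF inv, symmetric]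
    by (simp add: sum_2 cat_mult_add_right cat.mult_scale_right cat_scale_add_right)
  have lower_star: "(\<Sum>l\<in>UNIV. cat_mult hbar (cat_star hbar (G l i)) (H l j)) = L j i" for i j
  proof -
    \<comment> \<open>The left slot produces the star of a lowered symbol; hermiticity of these
      symbols removes it.\<close>
    have "(\<Sum>l\<in>UNIV. cat_mult hbar (cat_star hbar (G l i)) (H l j)) = cat_star hbar (L j i)"
      by (simp add: cat_star_sum cat_star_mult star flip: lower)
    also have "\<dots> = L j i"
      by (simp add: L_def cat_star_sum cat.star_scale christoffel_lower_star[OF star sym])
    finally show ?thesis .
  qed
  have "L j i + L i j = cat_comb c (H i j)" for i j
    by (simp add: L_def cat_comb_def christoffel_lower_metric[OF sym]
        flip: sum.distrib cat_scale_add_right)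
  then have "cat_form hbar (\<lambda>i j. L j i) U V + cat_form hbar L U V =
      cat_form hbar (\<lambda>i j. cat_comb c (H i j)) U V"
    by (simp add: cat_form_add_matrix)
  then show ?thesis
    unfolding D cat_form_add_left cat_form_add_right cat_form_matrix_left cat_form_matrix_right
      lower lower_star
    by (simp add: c cat_comb_form algebra_simps)
qed

section \<open>Uniqueness from the Koszul formula\<close>

lemma cat_phi_comb_0: "cat_phi (cat_comb 0) = 0"
  by (simp add: cat_phi_comb vec_eq_iff)

lemma commutator_cat_deriv: "cat.commutator (cat_deriv i) (cat_deriv j) = cat_comb 0"
  by (simp add: commutator_cat_comb flip: cat_comb_axis)

lemma cat_form_zero_right: "cat_form hbar H U 0 = 0"
  by (simp add: cat_form_def)

text \<open>The basic derivations commute, so the Koszul formula yields the lowered symbols. The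
  inverse metric then isolates each component.\<close>

lemma pseudo_riemannian_connection_christoffel:
  assumes inv: "\<And>i k. (\<Sum>j\<in>UNIV. cat_mult hbar (Hinv i j) (H j k)) = (if i = k then 1 else 0)"
    and "cat_pseudo_riemannian_calculus hbar H D"
  shows "D (cat_deriv i) (cat_basis j) $ l = christoffel hbar H Hinv l i j"
proof -
  interpret P: pseudo_riemannian_calculus cat_scale "cat_mult hbar" 1 "cat_star hbar"
      "cat_act hbar" "cat_form hbar H" cat_lie cat_phi D
    by fact
  have koszul: "cat_scale 2 (cat_form hbar H (cat_basis k) (D (cat_deriv i) (cat_basis j))) =
      cat_deriv i (H j k) + cat_deriv j (H k i) - cat_deriv k (H i j)" for k
    using P.koszul[OF cat_deriv_in_lie cat_deriv_in_lie cat_deriv_in_lie, of k i j]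
    by (simp add: cat_phi_deriv cat_form_basis commutator_cat_deriv cat_phi_comb_0
        cat_form_zero_right)
  have "cat_form hbar H (cat_basis k) (D (cat_deriv i) (cat_basis j)) = christoffel_lower H k i j" for k
    by (simp add: christoffel_lower_def cat_scale_scale cat_scale_one flip: koszul)
  then show ?thesis
    by (simp add: christoffel_eq_lower cat_component_from_form[OF inv, of "D (cat_deriv i) (cat_basis j)"])
qed

lemma pseudo_riemannian_connection_eq:
  assumes inv: "\<And>i k. (\<Sum>j\<in>UNIV. cat_mult hbar (Hinv i j) (H j k)) = (if i = k then 1 else 0)"
    and P: "cat_pseudo_riemannian_calculus hbar H D" and "d \<in> cat_lie"
  shows "D d = cat_connection hbar (christoffel hbar H Hinv) d"
proof -
  have "cat.affine_connection hbar cat_lie D"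
    using P by (rule pseudo_riemannian_calculus.connection)
  then show ?thesis
    using affine_connection_eq_cat_connection[of hbar D d] \<open>d \<in> cat_lie\<close>
    by (auto simp: fun_eq_iff pseudo_riemannian_connection_christoffel[OF inv P])
qed

section \<open>Reality, torsion and existence\<close>

lemma cat_connection_phi:
  "cat_connection hbar G (cat_comb c) (cat_phi (cat_comb c')) $ l =
    (\<Sum>i\<in>UNIV. \<Sum>m\<in>UNIV. cat_scale (of_real (c $ i * c' $ m)) (G l i m))"
proof -
  \<comment> \<open>The components of \<open>cat_phi (cat_comb c')\<close> are real multiples of the
    unit, so only the symbols contribute.\<close>
  have "cat_comb c 1 = 0" by (simp add: cat_comb_2)
  then show ?thesis
    by (simp add: cat_connection_comb cat_phi_comb cat_comb_scale sum_2 cat.mult_scale_right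
        cat.mult_unit_right cat_scale_add_right cat_scale_scale algebra_simps)
qed

text \<open>This displays the pairing as a real combination of hermitian elements, which gives the
  reality of the connection.\<close>

lemma cat_form_phi_connection:
  assumes inv: "\<And>i k. (\<Sum>j\<in>UNIV. cat_mult hbar (H k j) (Hinv j i)) = (if i = k then 1 else 0)"
  shows "cat_form hbar H (cat_phi (cat_comb c''))
      (cat_connection hbar (christoffel hbar H Hinv) (cat_comb c) (cat_phi (cat_comb c'))) =
    (\<Sum>k\<in>UNIV. \<Sum>i\<in>UNIV. \<Sum>j\<in>UNIV.
      cat_scale (of_real (c'' $ k * (c $ i * c' $ j))) (christoffel_lower H k i j))"
  unfolding cat_phi_comb_basis[of c'' hbar] cat_form_add_left cat_form_real_scale_left
    cat_form_basis_left cat_connection_phi christoffel_lower_eq[OF inv, symmetric]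
  by (simp add: sum_2 cat_mult_add_right cat.mult_scale_right cat_scale_add_right cat_scale_scale
      add_ac)

text \<open>The restriction replaces the junk values outside \<open>cat_lie\<close> by
  \<open>undefined\<close>, as membership in \<open>extensional cat_lie\<close> demands.\<close>

lemma pseudo_riemannian_calculus_exists:
  assumes star: "\<And>i j. cat_star hbar (H i j) = H j i"
    and sym: "\<And>i j. H j i = H i j"
    and inv: "\<And>i k. (\<Sum>j\<in>UNIV. cat_mult hbar (Hinv i j) (H j k)) = (if i = k then 1 else 0)"
    and inv': "\<And>i k. (\<Sum>j\<in>UNIV. cat_mult hbar (H k j) (Hinv j i)) = (if i = k then 1 else 0)"
  shows "cat_pseudo_riemannian_calculus hbar H
    (restrict (cat_connection hbar (christoffel hbar H Hinv)) cat_lie)"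
    (is "cat_pseudo_riemannian_calculus _ _ ?D")
proof -
  interpret R: real_metric_calculus cat_scale "cat_mult hbar" 1 "cat_star hbar"
      "cat_act hbar" "cat_form hbar H" cat_lie cat_phi
    by (rule cat_real_metric_calculus[OF star sym inv])
  show ?thesis
  proof unfold_locales
    show "cat.affine_connection hbar cat_lie ?D"
      \<comment> \<open>Linearity in the direction survives the restriction because
        \<open>cat_lie\<close> is closed under real combinations.\<close>
      using affine_connection_cat_connection[of hbar "christoffel hbar H Hinv"] R.lie_algebra
      by (simp add: cat.affine_connection_def cat.lie_algebra_of_hermitian_derivations_def)
    fix d d' E E' U V
    assume d: "d \<in> cat_lie"
    show "d (cat_form hbar H U V) = cat_form hbar H (?D d U) V + cat_form hbar H U (?D d V)"
      using cat_connection_metric[OF star sym inv' d] d by simp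
    show "cat_form hbar H (?D d E) E' = cat_star hbar (cat_form hbar H (?D d E) E')"
      if "E \<in> cat_phi ` cat_lie" "E' \<in> cat_phi ` cat_lie"
    proof -
      have "cat_star hbar (cat_form hbar H E' (?D d E)) = cat_form hbar H E' (?D d E)"
        using d that by (auto simp: cat_lie_def cat_form_phi_connection[OF inv'] cat_star_sum
            cat.star_scale christoffel_lower_star[OF star sym])
      then show ?thesis by (simp add: R.h_star)
    qed
    show "?D d (cat_phi d') - ?D d' (cat_phi d) - cat_phi (cat.commutator d d') = 0"
      if d': "d' \<in> cat_lie"
    proof -
      obtain c c' where c: "d = cat_comb c" "d' = cat_comb c'"
        using d d' by (auto simp: cat_lie_def)
      \<comment> \<open>Commutators vanish, so zero torsion is the symmetry of the Christoffel
        symbols in their lower indices.\<close>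
      have "cat_connection hbar (christoffel hbar H Hinv) d (cat_phi d') =
          cat_connection hbar (christoffel hbar H Hinv) d' (cat_phi d)"
        by (simp add: vec_eq_iff c cat_connection_phi sum_2 christoffel_sym[OF sym, where i = 2 and j = 1]
            algebra_simps)
      then show ?thesis
        using d d' by (simp add: c commutator_cat_comb cat_phi_comb_0)
    qed
  qed
qed

text \<open>A connection is a map on \<open>cat_lie\<close> only, while \<open>D\<close> is a total
  function; extensionality fixes the remaining values, so that uniqueness becomes an equality of
  functions.\<close>

lemma ex1_pseudo_riemannian_calculus:
  assumes star: "\<And>i j. cat_star hbar (H i j) = H j i"
    and sym: "\<And>i j. H j i = H i j"
    and inv: "\<And>i k. (\<Sum>j\<in>UNIV. cat_mult hbar (Hinv i j) (H j k)) = (if i = k then 1 else 0)"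
    and inv': "\<And>i k. (\<Sum>j\<in>UNIV. cat_mult hbar (H k j) (Hinv j i)) = (if i = k then 1 else 0)"
  shows "\<exists>!D. D \<in> extensional cat_lie \<and> cat_pseudo_riemannian_calculus hbar H D"
proof (rule ex1I)
  let ?D = "restrict (cat_connection hbar (christoffel hbar H Hinv)) cat_lie"
  show "?D \<in> extensional cat_lie \<and> cat_pseudo_riemannian_calculus hbar H ?D"
    using pseudo_riemannian_calculus_exists[OF star sym inv inv'] by simp
  fix D assume "D \<in> extensional cat_lie \<and> cat_pseudo_riemannian_calculus hbar H D"
  then show "D = ?D"
    by (intro extensionalityI[of _ cat_lie]) (auto simp: pseudo_riemannian_connection_eq[OF inv])
qed

section \<open>Conformally flat metrics\<close>

text \<open>At exponent zero there is no shift, so the functions of u form a commutative subalgebra,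
  whatever \<open>hbar\<close> is.\<close>

lemma fun_of_u_mult: "cat_mult hbar (fun_of_u f) (fun_of_u g) = fun_of_u (f * g)"
  by (simp add: cat_mult_single)

lemma cat_deriv_fun_of_u: "cat_deriv i (fun_of_u f) = (if i = 1 then fun_of_u (smooth_deriv f) else 0)"
  by (simp add: cat_deriv_single)

text \<open>A diagonal metric leaves a single summand in each inverse relation, and
  \<open>smooth_exp (- f)\<close> cancels the exponential from the right.\<close>

lemma conformal_inverse:
  fixes H Hinv :: "2 \<Rightarrow> 2 \<Rightarrow> catenoid"
  assumes inv: "\<And>i k. (\<Sum>j\<in>UNIV. cat_mult hbar (Hinv i j) (H j k)) = (if i = k then 1 else 0)"
    and H: "\<And>i j. H i j = (if i = j then fun_of_u (smooth_exp f) else 0)"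
  shows "Hinv i j = (if i = j then fun_of_u (smooth_exp (- f)) else 0)"
proof -
  have "cat_mult hbar (Hinv i j) (fun_of_u (smooth_exp f)) = (if i = j then 1 else 0)"
    using inv[of i j] exhaust_2[of j] by (auto simp: H sum_2 split: if_splits)
  then have "cat_mult hbar (cat_mult hbar (Hinv i j) (fun_of_u (smooth_exp f))) (fun_of_u (smooth_exp (- f)))
      = (if i = j then fun_of_u (smooth_exp (- f)) else 0)"
    by (simp add: cat.mult_unit_left)
  then show ?thesis
    by (simp add: cat_mult_assoc fun_of_u_mult cat.mult_unit_right flip: smooth_exp_add)
qed

text \<open>The metric depends on u alone, so only derivatives along \<open>cat_deriv 1\<close>
  survive, and the classical computation takes place among commuting functions of u.\<close>

lemma conformal_christoffel:
  assumes inv: "\<And>i k. (\<Sum>j\<in>UNIV. cat_mult hbar (Hinv i j) (H j k)) = (if i = k then 1 else 0)"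
    and H: "\<And>i j. H i j = (if i = j then fun_of_u (smooth_exp (2 * k)) else 0)"
  shows "christoffel hbar H Hinv l i j =
    (if l = 1 then if i = 1 \<and> j = 1 then fun_of_u (smooth_deriv k)
       else if i = 2 \<and> j = 2 then - fun_of_u (smooth_deriv k) else 0
     else if i \<noteq> j then fun_of_u (smooth_deriv k) else 0)"
proof -
  let ?E = "smooth_exp (2 * k)" and ?k' = "smooth_deriv k"
  have "smooth_exp (- (2 * k)) * smooth_deriv ?E = ?k' + ?k'"
  proof -
    \<comment> \<open>Splitting \<open>2 * k\<close> as \<open>k + k\<close> produces the doubled
      term that the factor one half cancels.\<close>
    have "smooth_deriv ?E = (?k' + ?k') * ?E"
      unfolding smooth_deriv_exp mult_2[of k] smooth_deriv_add ..
    moreover have "smooth_exp (- (2 * k)) * ?E = 1"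
      by (simp flip: smooth_exp_add)
    ultimately show ?thesis by (metis mult.left_commute mult.right_neutral)
  qed
  then have half: "cat_scale (1/2) (cat_mult hbar (fun_of_u (smooth_exp (- (2 * k))))
      (fun_of_u (smooth_deriv ?E))) = fun_of_u ?k'"
    unfolding fun_of_u_mult by (simp only: single_add cat_scale_half)
  show ?thesis
    using exhaust_2[of l] exhaust_2[of i] exhaust_2[of j]
    by (auto simp: christoffel_def conformal_inverse[OF inv H] H sum_2 cat_deriv_fun_of_u half
        cat_mult_minus_right cat.scale_minus_right)
qed

text \<open>The diagonal inverse metric leaves the coefficients with i = j and k = l, and those with
  i = k vanish as well. The remaining two summands are equal.\<close>

lemma conformal_gaussian_curvature:
  assumes inv: "\<And>i k. (\<Sum>j\<in>UNIV. cat_mult hbar (Hinv i j) (H j k)) = (if i = k then 1 else 0)"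
    and H: "\<And>i j. H i j = (if i = j then fun_of_u (smooth_exp (2 * k)) else 0)"
    and P: "cat_pseudo_riemannian_calculus hbar H D"
  shows "gaussian_curvature hbar H Hinv D =
    - fun_of_u (smooth_exp (- 2 * k) * smooth_deriv (smooth_deriv k))"
proof -
  let ?E = "smooth_exp (2 * k)" and ?Ei = "smooth_exp (- (2 * k))"
    and ?k'' = "smooth_deriv (smooth_deriv k)"
  have D: "D (cat_deriv i) U $ l =
      cat_deriv i (U $ l) + (\<Sum>m\<in>UNIV. cat_mult hbar (christoffel hbar H Hinv l i m) (U $ m))"
    for i U l
    by (simp add: pseudo_riemannian_connection_eq[OF inv P cat_deriv_in_lie] cat_connection_deriv)
  note simps = curvature_def D sum_2 conformal_christoffel[OF inv H] cat_basis_nth cat.mult_unit_right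
    cat_deriv_minus cat_deriv_fun_of_u cat_mult_minus_left cat_mult_minus_right fun_of_u_mult
  have curv: "curvature D 1 1 U = 0" "curvature D 2 2 U = 0"
    "curvature D 1 2 (cat_basis 2) $ 1 = - fun_of_u ?k''"
    "curvature D 2 1 (cat_basis 1) $ 2 = - fun_of_u ?k''" for U
    by (simp_all add: simps)
  \<comment> \<open>The outer factors come from the inverse metric, the inner exponential from
    lowering the curvature index.\<close>
  have E: "?Ei * (?E * ?k'') * ?Ei = ?Ei * ?k''"
  proof -
    have "?Ei * ?E = 1" by (simp flip: smooth_exp_add)
    then show ?thesis by (metis mult.assoc mult.commute mult.right_neutral)
  qed
  have "gaussian_curvature hbar H Hinv D =
      cat_scale (1/2) (- fun_of_u (?Ei * (?E * ?k'') * ?Ei) + - fun_of_u (?Ei * (?E * ?k'') * ?Ei))"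
    by (simp add: gaussian_curvature_def curvature_coeff_def cat_form_basis_left
        conformal_inverse[OF inv H] H sum_2 curv fun_of_u_mult cat_mult_minus_left cat_mult_minus_right)
  then show ?thesis
    unfolding cat_scale_half E by simp
qed

theorem mainTheorem10:
  fixes hbar :: real
    and H Hinv :: "2 \<Rightarrow> 2 \<Rightarrow> catenoid"
  assumes "\<And>i j. cat_star hbar (H i j) = H j i"
    and "\<And>i j. H j i = H i j"
    and "\<And>i k. (\<Sum>j\<in>UNIV. cat_mult hbar (Hinv i j) (H j k)) = (if i = k then 1 else 0)"
    and "\<And>i k. (\<Sum>j\<in>UNIV. cat_mult hbar (H k j) (Hinv j i)) = (if i = k then 1 else 0)"
  shows "cat_real_metric_calculus hbar H \<and>
    (\<exists>!D. D \<in> extensional cat_lie \<and> cat_pseudo_riemannian_calculus hbar H D) \<and>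
    (\<forall>D. cat_pseudo_riemannian_calculus hbar H D \<longrightarrow>
      (\<forall>i j. D (cat_deriv i) (cat_basis j) =
         (\<Sum>l\<in>UNIV. cat_act hbar (cat_basis l) (christoffel hbar H Hinv l i j))) \<and>
      (\<forall>k. (\<forall>u. smooth_apply k u \<in> \<real>) \<and>
           (\<forall>i j. H i j = (if i = j then fun_of_u (smooth_exp (2 * k)) else 0)) \<longrightarrow>
         D (cat_deriv 1) (cat_basis 1) = cat_act hbar (cat_basis 1) (fun_of_u (smooth_deriv k)) \<and>
         D (cat_deriv 1) (cat_basis 2) = cat_act hbar (cat_basis 2) (fun_of_u (smooth_deriv k)) \<and>
         D (cat_deriv 2) (cat_basis 1) = cat_act hbar (cat_basis 2) (fun_of_u (smooth_deriv k)) \<and>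
         D (cat_deriv 2) (cat_basis 2) = - cat_act hbar (cat_basis 1) (fun_of_u (smooth_deriv k)) \<and>
         gaussian_curvature hbar H Hinv D =
           - fun_of_u (smooth_exp (- 2 * k) * smooth_deriv (smooth_deriv k))))"
proof (intro conjI allI impI; (elim conjE)?)
  show "cat_real_metric_calculus hbar H"
    by (rule cat_real_metric_calculus[OF assms(1-3)])
  show "\<exists>!D. D \<in> extensional cat_lie \<and> cat_pseudo_riemannian_calculus hbar H D"
    by (rule ex1_pseudo_riemannian_calculus[OF assms])
  fix D assume P: "cat_pseudo_riemannian_calculus hbar H D"
  note D = pseudo_riemannian_connection_christoffel[OF assms(3) P]
  show "D (cat_deriv i) (cat_basis j) =
      (\<Sum>l\<in>UNIV. cat_act hbar (cat_basis l) (christoffel hbar H Hinv l i j))" for i j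
    \<comment> \<open>The known components are reassembled by expanding the left side in the
      basis.\<close>
    by (subst cat_basis_expansion[of _ hbar]) (simp add: D)
  fix k assume "\<forall>i j. H i j = (if i = j then fun_of_u (smooth_exp (2 * k)) else 0)"
  then have H: "\<And>i j. H i j = (if i = j then fun_of_u (smooth_exp (2 * k)) else 0)" by blast
  note simps = vec_eq_iff forall_2 D conformal_christoffel[OF assms(3) H] cat_basis_nth
    cat.mult_unit_left
  show "D (cat_deriv 1) (cat_basis 1) = cat_act hbar (cat_basis 1) (fun_of_u (smooth_deriv k))"
    "D (cat_deriv 1) (cat_basis 2) = cat_act hbar (cat_basis 2) (fun_of_u (smooth_deriv k))"
    "D (cat_deriv 2) (cat_basis 1) = cat_act hbar (cat_basis 2) (fun_of_u (smooth_deriv k))"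
    "D (cat_deriv 2) (cat_basis 2) = - cat_act hbar (cat_basis 1) (fun_of_u (smooth_deriv k))"
    by (simp_all add: simps)
  show "gaussian_curvature hbar H Hinv D =
      - fun_of_u (smooth_exp (- 2 * k) * smooth_deriv (smooth_deriv k))"
    by (rule conformal_gaussian_curvature[OF assms(3) H P])
qed

end
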